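(* Let $\Phi=B_n$ or $D_n$, let $D\subset\Phi^+$ be an orthogonal rook placement, let $\xi=(\xi_\beta)_{\beta\in D}$ be a tuple of non-zero scalars from $\mathbb{F}_q$, and let $f=f_{D,\xi}=\sum_{\beta\in D}\xi_\beta e_\beta^*\in\mathfrak{u}^*$ (the canonical form on the coadjoint orbit associated with $D$ and $\xi$). Then $\mathfrak{p}=\mathfrak{p}_D$ is a polarization for $f$.
   Context: Standing assumption: $\mathbb{F}_q$ is a finite field of characteristic $p\geq n$. Root systems. Let $\epsilon_1,\dots,\epsilon_n$ be the standard basis of $\mathbb{R}^n$. $B_n=\{\pm\epsilon_i\pm\epsilon_j,\ i<j\}\cup\{\pm\epsilon_i\}$, $D_n=\{\pm\epsilon_i\pm\epsilon_j,\ i<j\}$; the positive roots are $B_n^+=\{\epsilon_i\pm\epsilon_j,\ 1\le i<j\le n\}\cup\{\epsilon_i,\ 1\le i\le n\}$ and $D_n^+=\{\epsilon_i\pm\epsilon_j,\ 1\le i<j\le n\}$. For positive roots put $\mathrm{col}(\epsilon_i\pm\epsilon_j)=\mathrm{col}(\epsilon_i)=i$, $\mathrm{row}(\epsilon_i\pm\epsilon_j)=\mp j$ (for $i<j$), $\mathrm{row}(\epsilon_i)=0$. Let $R_i=\{\alpha\in\Phi^+\mid\mathrm{row}(\alpha)=i\}$ for $-n+1\le i\le n-1$ and $C_j=\{\alpha\in\Phi^+\mid\mathrm{col}(\alpha)=j\}$ for $1\le j\le n$. Lie algebra. Let $m=2n+1$ for $\Phi=B_n$ and $m=2n$ for $\Phi=D_n$.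 Rows and columns of $m\times m$ matrices are indexed by $1,2,\dots,n,0,-n,\dots,-2,-1$ in this order (no index $0$ for $D_n$), and $e_{a,b}$ are the elementary matrices. Put $e_{\epsilon_i}=e_{0,i}-e_{-i,0}$, $e_{\epsilon_i-\epsilon_j}=e_{j,i}-e_{-i,-j}$, $e_{\epsilon_i+\epsilon_j}=e_{-j,i}-e_{-i,j}$ ($i<j$). Then $\mathfrak{u}=\mathfrak{u}(\Phi)\subset\mathfrak{gl}_m(\mathbb{F}_q)$ is the Lie subalgebra with basis $e_\alpha$, $\alpha\in\Phi^+$; $e_\alpha^*$ denotes the dual basis of $\mathfrak{u}^*$. Orthogonal rook placement: a subset $D\subset\Phi^+$ of pairwise orthogonal roots with $|D\cap R_i|\le1$ and $|D\cap C_j|\le1$ for all $i,j$. Write $D=\{\beta_1,\dots,\beta_t\}$ with $\mathrm{col}(\beta_1)<\dots<\mathrm{col}(\beta_t)$. Singular roots. For $\beta\in\Phi^+$, $S(\beta)$ is the set of all $\alpha\in\Phi^+$ for which there is $\gamma\in\Phi^+$ with $\alpha+\gamma=\beta$; $S^+(\beta)=\{\alpha\in S(\beta)\mid\mathrm{col}(\alpha)=\mathrm{col}(\beta)\}$, $S^-(\beta)=S(\beta)\setminus S^+(\beta)$. (In each pair $\alpha+\gamma=\beta$ exactly one root lies in $S^+(\beta)$.) Battleship. The map $\mathcal{F}_D\colon\Phi^+\to\{\otimes,\bullet,+,-\}$ is defined in steps. Step $0$: $\mathcal{F}_D(\beta)=\otimes$ for $\beta\in D$. Step $i$, for $i=1,\dots,t$: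 for all $\gamma\in S^+(\beta_i)$, $\delta\in S^-(\beta_i)$ with $\gamma+\delta=\beta_i$ such that neither $\gamma$ nor $\delta$ was mapped to $-$ at any of the steps $0,\dots,i-1$, put $\mathcal{F}_D(\gamma)=+$ and $\mathcal{F}_D(\delta)=-$. Finally $\mathcal{F}_D(\alpha)=\bullet$ for all remaining roots. Let $\mathcal{P}_D=\{\alpha\in\Phi^+\mid\mathcal{F}_D(\alpha)\ne-\}$ and let $\mathfrak{p}_D$ be the span of $e_\alpha$, $\alpha\in\mathcal{P}_D$. Polarization: for a Lie algebra $\mathfrak{g}$ and $f\in\mathfrak{g}^*$, a subspace $\mathfrak{p}$ is $f$-isotropic if $f([x,y])=0$ for all $x,y\in\mathfrak{p}$; a polarization for $f$ is a Lie subalgebra that is $f$-isotropic and is maximal among $f$-isotropic subspaces. *)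

theory Defs
  imports
    Complex_Main
    "HOL-Library.Function_Algebras"
    "HOL-Computational_Algebra.Primes"
begin

section \<open>Positive roots\<close>

datatype root_type = Type_B | Type_D

text \<open>
  A positive root is represented by its name: \<open>Eps i\<close>, \<open>Eps_minus i j\<close>, \<open>Eps_plus i j\<close> stand for
  $\epsilon_i$, $\epsilon_i - \epsilon_j$ and $\epsilon_i + \epsilon_j$. The vector it denotes is
  \<open>root_vec\<close>; sums and inner products of roots are always taken between these vectors.
  A vector of $\mathbf{R}^n$ is a function \<open>nat \<Rightarrow> real\<close> vanishing outside \<open>{1..n}\<close>,
  added pointwise.
\<close>

datatype root = Eps nat | Eps_minus nat nat | Eps_plus nat nat

definition std_basis :: "nat \<Rightarrow> nat \<Rightarrow> real" where
  "std_basis i = (\<lambda>k. if k = i then 1 else 0)"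

definition inner_prod :: "nat \<Rightarrow> (nat \<Rightarrow> real) \<Rightarrow> (nat \<Rightarrow> real) \<Rightarrow> real" where
  "inner_prod n x y = (\<Sum>k=1..n. x k * y k)"

fun root_vec :: "root \<Rightarrow> nat \<Rightarrow> real" where
  "root_vec (Eps i) = std_basis i"
| "root_vec (Eps_minus i j) = std_basis i - std_basis j"
| "root_vec (Eps_plus i j) = std_basis i + std_basis j"

definition pos_roots :: "root_type \<Rightarrow> nat \<Rightarrow> root set" where
  "pos_roots \<Phi> n =
     {Eps_minus i j | i j. 1 \<le> i \<and> i < j \<and> j \<le> n}
   \<union> {Eps_plus i j | i j. 1 \<le> i \<and> i < j \<and> j \<le> n}
   \<union> (if \<Phi> = Type_B then {Eps i | i. 1 \<le> i \<and> i \<le> n} else {})"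

fun col :: "root \<Rightarrow> nat" where
  "col (Eps i) = i"
| "col (Eps_minus i j) = i"
| "col (Eps_plus i j) = i"

fun row :: "root \<Rightarrow> int" where
  "row (Eps i) = 0"
| "row (Eps_minus i j) = int j"
| "row (Eps_plus i j) = - int j"

definition root_row :: "root_type \<Rightarrow> nat \<Rightarrow> int \<Rightarrow> root set" where
  "root_row \<Phi> n i = {\<alpha> \<in> pos_roots \<Phi> n. row \<alpha> = i}"

definition root_col :: "root_type \<Rightarrow> nat \<Rightarrow> nat \<Rightarrow> root set" where
  "root_col \<Phi> n j = {\<alpha> \<in> pos_roots \<Phi> n. col \<alpha> = j}"

text \<open>
  The row indices run from $-n+1$ to $n-1$ only. Nothing is lost for the rows $\pm n$: two distinct
  roots in the same non-zero row are never orthogonal.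
\<close>

definition orthogonal_rook_placement :: "root_type \<Rightarrow> nat \<Rightarrow> root set \<Rightarrow> bool" where
  "orthogonal_rook_placement \<Phi> n D \<longleftrightarrow>
     D \<subseteq> pos_roots \<Phi> n \<and>
     pairwise (\<lambda>\<alpha> \<beta>. inner_prod n (root_vec \<alpha>) (root_vec \<beta>) = 0) D \<and>
     (\<forall>i \<in> {- int n + 1 .. int n - 1}. card (D \<inter> root_row \<Phi> n i) \<le> 1) \<and>
     (\<forall>j \<in> {1..n}. card (D \<inter> root_col \<Phi> n j) \<le> 1)"

definition singular :: "root_type \<Rightarrow> nat \<Rightarrow> root \<Rightarrow> root set" where
  "singular \<Phi> n \<beta> =
     {\<alpha> \<in> pos_roots \<Phi> n. \<exists>\<gamma> \<in> pos_roots \<Phi> n. root_vec \<alpha> + root_vec \<gamma> = root_vec \<beta>}"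

definition singular_plus :: "root_type \<Rightarrow> nat \<Rightarrow> root \<Rightarrow> root set" where
  "singular_plus \<Phi> n \<beta> = {\<alpha> \<in> singular \<Phi> n \<beta>. col \<alpha> = col \<beta>}"

definition singular_minus :: "root_type \<Rightarrow> nat \<Rightarrow> root \<Rightarrow> root set" where
  "singular_minus \<Phi> n \<beta> = singular \<Phi> n \<beta> - singular_plus \<Phi> n \<beta>"


section \<open>The battleship map\<close>

datatype mark = Otimes | Bullet | Plus | Minus

text \<open>
  The state after step $i$ assigns to each root its mark, or \<open>None\<close> if it has not been marked so far.
  The condition that a root was not mapped to \<open>Minus\<close> at any earlier step is tested on the state
  before the current step; this is the same, since by that very condition a root that carries
  \<open>Minus\<close> is never marked again.
\<close>

definition admissible_pair ::
    "root_type \<Rightarrow> nat \<Rightarrow> (root \<Rightarrow> mark option) \<Rightarrow> root \<Rightarrow> root \<Rightarrow> root \<Rightarrow> bool" where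
  "admissible_pair \<Phi> n F \<beta> \<gamma> \<delta> \<longleftrightarrow>
     \<gamma> \<in> singular_plus \<Phi> n \<beta> \<and> \<delta> \<in> singular_minus \<Phi> n \<beta> \<and>
     root_vec \<gamma> + root_vec \<delta> = root_vec \<beta> \<and>
     F \<gamma> \<noteq> Some Minus \<and> F \<delta> \<noteq> Some Minus"

definition battleship_init :: "root set \<Rightarrow> root \<Rightarrow> mark option" where
  "battleship_init D = (\<lambda>\<alpha>. if \<alpha> \<in> D then Some Otimes else None)"

definition battleship_step ::
    "root_type \<Rightarrow> nat \<Rightarrow> root \<Rightarrow> (root \<Rightarrow> mark option) \<Rightarrow> root \<Rightarrow> mark option" where
  "battleship_step \<Phi> n \<beta> F = (\<lambda>\<alpha>.
     if \<exists>\<delta>. admissible_pair \<Phi> n F \<beta> \<alpha> \<delta> then Some Plus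
     else if \<exists>\<gamma>. admissible_pair \<Phi> n F \<beta> \<gamma> \<alpha> then Some Minus
     else F \<alpha>)"

text \<open>
  The roots of \<open>D\<close> are processed by increasing column; for a rook placement \<open>col\<close> is injective
  on \<open>D\<close>.
\<close>

definition battleship :: "root_type \<Rightarrow> nat \<Rightarrow> root set \<Rightarrow> root \<Rightarrow> mark" where
  "battleship \<Phi> n D \<alpha> =
     (case fold (battleship_step \<Phi> n) (sorted_key_list_of_set col D) (battleship_init D) \<alpha> of
        None \<Rightarrow> Bullet
      | Some m \<Rightarrow> m)"

definition P_set :: "root_type \<Rightarrow> nat \<Rightarrow> root set \<Rightarrow> root set" where
  "P_set \<Phi> n D = {\<alpha> \<in> pos_roots \<Phi> n. battleship \<Phi> n D \<alpha> \<noteq> Minus}"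


section \<open>The Lie algebra\<close>

text \<open>
  An $m \times m$ matrix is a function \<open>int \<Rightarrow> int \<Rightarrow> 'a\<close> of its row and column label vanishing
  outside the label set \<open>mat_index \<Phi> n\<close>, of size $m = 2n+1$ (type B) or $m = 2n$ (type D).
  Addition is pointwise; the product is the matrix product \<open>mat_mult\<close>, not the pointwise one.
\<close>

type_synonym 'a matrix = "int \<Rightarrow> int \<Rightarrow> 'a"

definition mat_index :: "root_type \<Rightarrow> nat \<Rightarrow> int set" where
  "mat_index \<Phi> n = (if \<Phi> = Type_B then {- int n .. int n} else {- int n .. int n} - {0})"

definition mat_scale :: "'a::field \<Rightarrow> 'a matrix \<Rightarrow> 'a matrix" where
  "mat_scale c A = (\<lambda>a b. c * A a b)"

interpretation mat: vector_space mat_scale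
  by unfold_locales (auto simp: mat_scale_def fun_eq_iff algebra_simps)

definition mat_mult :: "root_type \<Rightarrow> nat \<Rightarrow> 'a::field matrix \<Rightarrow> 'a matrix \<Rightarrow> 'a matrix" where
  "mat_mult \<Phi> n A B = (\<lambda>a b. \<Sum>c\<in>mat_index \<Phi> n. A a c * B c b)"

definition bracket :: "root_type \<Rightarrow> nat \<Rightarrow> 'a::field matrix \<Rightarrow> 'a matrix \<Rightarrow> 'a matrix" where
  "bracket \<Phi> n A B = mat_mult \<Phi> n A B - mat_mult \<Phi> n B A"

definition elem_mat :: "int \<Rightarrow> int \<Rightarrow> 'a::field matrix" where
  "elem_mat a b = (\<lambda>c d. if c = a \<and> d = b then 1 else 0)"

fun root_mat :: "root \<Rightarrow> 'a::field matrix" where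
  "root_mat (Eps i) = elem_mat 0 (int i) - elem_mat (- int i) 0"
| "root_mat (Eps_minus i j) = elem_mat (int j) (int i) - elem_mat (- int i) (- int j)"
| "root_mat (Eps_plus i j) = elem_mat (- int j) (int i) - elem_mat (- int i) (int j)"

definition u_alg :: "root_type \<Rightarrow> nat \<Rightarrow> 'a::field matrix set" where
  "u_alg \<Phi> n = mat.span (root_mat ` pos_roots \<Phi> n)"

text \<open>
  $e_\beta^*(x)$ is the coordinate of $x \in \mathfrak{u}$ at $e_\beta$ in the basis
  $(e_\alpha)_{\alpha \in \Phi^+}$. Linear forms on $\mathfrak{u}$ are total functions whose values
  outside $\mathfrak{u}$ are irrelevant.
\<close>

definition dual_root :: "root_type \<Rightarrow> nat \<Rightarrow> root \<Rightarrow> 'a::field matrix \<Rightarrow> 'a" where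
  "dual_root \<Phi> n \<beta> x = mat.representation (root_mat ` pos_roots \<Phi> n) x (root_mat \<beta>)"

definition canonical_form ::
    "root_type \<Rightarrow> nat \<Rightarrow> root set \<Rightarrow> (root \<Rightarrow> 'a::field) \<Rightarrow> 'a matrix \<Rightarrow> 'a" where
  "canonical_form \<Phi> n D \<xi> x = (\<Sum>\<beta>\<in>D. \<xi> \<beta> * dual_root \<Phi> n \<beta> x)"

definition p_alg :: "root_type \<Rightarrow> nat \<Rightarrow> root set \<Rightarrow> 'a::field matrix set" where
  "p_alg \<Phi> n D = mat.span (root_mat ` P_set \<Phi> n D)"


section \<open>Polarizations\<close>

text \<open>Here \<open>br\<close> is the bracket of the Lie algebra of matrices with underlying space \<open>g\<close>.\<close>

definition lie_subalgebra ::
    "('a::field matrix \<Rightarrow> 'a matrix \<Rightarrow> 'a matrix) \<Rightarrow> 'a matrix set \<Rightarrow> 'a matrix set \<Rightarrow> bool" where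
  "lie_subalgebra br g p \<longleftrightarrow>
     mat.subspace p \<and> p \<subseteq> g \<and> (\<forall>x\<in>p. \<forall>y\<in>p. br x y \<in> p)"

definition isotropic_subspace ::
    "('a::field matrix \<Rightarrow> 'a matrix \<Rightarrow> 'a matrix) \<Rightarrow> 'a matrix set \<Rightarrow> ('a matrix \<Rightarrow> 'a) \<Rightarrow>
     'a matrix set \<Rightarrow> bool" where
  "isotropic_subspace br g f p \<longleftrightarrow>
     mat.subspace p \<and> p \<subseteq> g \<and> (\<forall>x\<in>p. \<forall>y\<in>p. f (br x y) = 0)"

definition polarization ::
    "('a::field matrix \<Rightarrow> 'a matrix \<Rightarrow> 'a matrix) \<Rightarrow> 'a matrix set \<Rightarrow> ('a matrix \<Rightarrow> 'a) \<Rightarrow>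
     'a matrix set \<Rightarrow> bool" where
  "polarization br g f p \<longleftrightarrow>
     lie_subalgebra br g p \<and> isotropic_subspace br g f p \<and>
     (\<forall>p'. isotropic_subspace br g f p' \<and> p \<subseteq> p' \<longrightarrow> p' = p)"

end

theory Submission
  imports Defs
begin

text \<open>
  A root marked \<open>Minus\<close> at the step of \<open>\<beta> \<in> D\<close> has a partner \<open>\<gamma>\<close> that is never marked \<open>Minus\<close>, with
  sum \<open>\<beta>\<close>; conversely each pair with sum in \<open>D\<close> contains a root marked \<open>Minus\<close>, so \<open>p\<close> is isotropic.
  For maximality, let \<open>x\<close> be orthogonal to \<open>p\<close> and let \<open>\<delta>\<close> be marked \<open>Minus\<close>, with partner \<open>\<gamma>\<close>. The value
  \<open>f [e\<^sub>\<gamma>, x]\<close> only involves the coordinate of \<open>x\<close> at \<open>\<delta>\<close> and those at roots marked at earlier steps,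
  so all these coordinates vanish, by induction on the column of \<open>\<beta>\<close>.
  All structure constants are \<open>\<plusminus>1\<close>.
\<close>

section \<open>Positive roots as pairs (row, column), and root addition in these terms\<close>

section \<open>Roots by row and column\<close>

lemma pos_root_bounds:
  assumes "\<alpha> \<in> pos_roots \<Phi> n"
  shows "1 \<le> col \<alpha>" "col \<alpha> \<le> n" "\<bar>row \<alpha>\<bar> \<le> int n"
    and "row \<alpha> = 0 \<and> \<Phi> = Type_B \<or> int (col \<alpha>) < \<bar>row \<alpha>\<bar>"
  using assms by (auto simp: pos_roots_def split: if_splits)

text \<open>The sign of the row tells the three constructors apart, so row and column together serve
  as coordinates on the positive roots.\<close>

lemma pos_root_eqI:
  assumes "\<alpha> \<in> pos_roots \<Phi> n" "\<beta> \<in> pos_roots \<Phi> n" "row \<alpha> = row \<beta>" "col \<alpha> = col \<beta>"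
  shows "\<alpha> = \<beta>"
  using assms by (auto simp: pos_roots_def split: if_splits)

text \<open>Converse of \<open>pos_root_bounds\<close>: the inequalities there describe exactly
  which pairs occur. The sign of \<open>r\<close> selects the constructor.\<close>

lemma pos_root_exists:
  assumes "1 \<le> c" "c \<le> n" "\<bar>r\<bar> \<le> int n" "r = 0 \<and> \<Phi> = Type_B \<or> int c < \<bar>r\<bar>"
  obtains \<alpha> where "\<alpha> \<in> pos_roots \<Phi> n" "row \<alpha> = r" "col \<alpha> = c"
proof (cases r "0 :: int" rule: linorder_cases)
  case less
  then show ?thesis
    using assms by (intro that[of "Eps_plus c (nat (- r))"]) (auto simp: pos_roots_def)
next
  case equal
  then show ?thesis
    using assms by (intro that[of "Eps c"]) (auto simp: pos_roots_def)
next
  case greater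
  then show ?thesis
    using assms by (intro that[of "Eps_minus c (nat r)"]) (auto simp: pos_roots_def)
qed

lemma finite_pos_roots: "finite (pos_roots \<Phi> n)"
proof (rule finite_subset)
  show "pos_roots \<Phi> n \<subseteq> (\<lambda>(i, j). Eps_minus i j) ` ({..n} \<times> {..n})
      \<union> (\<lambda>(i, j). Eps_plus i j) ` ({..n} \<times> {..n}) \<union> Eps ` {..n}"
    by (auto simp: pos_roots_def image_iff split: if_splits)
qed auto

text \<open>Coordinate form of \<alpha> + \<gamma> = \<delta>. In the first two alternatives the
  column of one summand cancels against the row of the other; in the third the two rows cancel (or
  are both 0) and the two columns remain, which \<open>min\<close> and \<open>max\<close> put in
  order.\<close>

definition root_sum_rel :: "root \<Rightarrow> root \<Rightarrow> root \<Rightarrow> bool" where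
  "root_sum_rel \<alpha> \<gamma> \<delta> \<longleftrightarrow>
     row \<gamma> = int (col \<alpha>) \<and> row \<delta> = row \<alpha> \<and> col \<delta> = col \<gamma> \<or>
     row \<alpha> = int (col \<gamma>) \<and> row \<delta> = row \<gamma> \<and> col \<delta> = col \<alpha> \<or>
     row \<alpha> = - row \<gamma> \<and> col \<alpha> \<noteq> col \<gamma> \<and> col \<delta> = min (col \<alpha>) (col \<gamma>) \<and>
       row \<delta> = - int (max (col \<alpha>) (col \<gamma>))"

text \<open>One formula for all three constructors: row r contributes the basis vector of index |r|
  with sign opposite to r, and row 0 contributes nothing.\<close>

lemma root_vec_eq:
  assumes "\<alpha> \<in> pos_roots \<Phi> n" "1 \<le> k"
  shows "root_vec \<alpha> k =
    of_bool (k = col \<alpha>) + of_bool (row \<alpha> = - int k) - of_bool (row \<alpha> = int k)"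
  using assms by (auto simp: pos_roots_def std_basis_def split: if_splits)

lemma root_vec_below_col:
  assumes "\<alpha> \<in> pos_roots \<Phi> n" "k < col \<alpha>"
  shows "root_vec \<alpha> k = 0"
  using assms by (auto simp: pos_roots_def std_basis_def split: if_splits)

lemma root_vec_col:
  assumes "\<alpha> \<in> pos_roots \<Phi> n"
  shows "root_vec \<alpha> (col \<alpha>) = 1"
  using assms by (auto simp: pos_roots_def std_basis_def split: if_splits)

lemma root_sum_rel_commute: "root_sum_rel \<alpha> \<gamma> \<delta> \<longleftrightarrow> root_sum_rel \<gamma> \<alpha> \<delta>"
  by (auto simp: root_sum_rel_def min.commute max.commute)

text \<open>A non-zero row is visible, with its sign, at the coordinate |r|, while row 0 gives the
  zero vector; testing these coordinates recovers the row.\<close>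

lemma row_eqI:
  fixes a b :: int
  assumes "\<And>k::nat. 1 \<le> k \<Longrightarrow> (of_bool (a = - int k) - of_bool (a = int k) :: real) =
    of_bool (b = - int k) - of_bool (b = int k)"
  shows "a = b"
proof (cases "a = 0")
  case True
  then show ?thesis
    using assms[of "nat b"] assms[of "nat (- b)"] by (cases b "0 :: int" rule: linorder_cases) (auto simp: Suc_le_eq)
next
  case False
  then show ?thesis
    using assms[of "nat a"] assms[of "nat (- a)"]
    by (cases a "0 :: int" rule: linorder_cases) (auto simp: Suc_le_eq of_bool_def split: if_splits)
qed

lemma root_vec_add_imp_rel_less:
  assumes \<alpha>: "\<alpha> \<in> pos_roots \<Phi> n" and \<gamma>: "\<gamma> \<in> pos_roots \<Phi> n" and \<delta>: "\<delta> \<in> pos_roots \<Phi> n"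
    and sum: "root_vec \<alpha> + root_vec \<gamma> = root_vec \<delta>" and less: "col \<alpha> < col \<gamma>"
  shows "root_sum_rel \<alpha> \<gamma> \<delta>"
proof -
  have *: "root_vec \<alpha> k + root_vec \<gamma> k = root_vec \<delta> k" for k
    using sum by (metis plus_fun_apply)
  \<comment> \<open>The column is the position of the first non-zero coordinate, and the sum starts
    where \<alpha> starts.\<close>
  have col: "col \<delta> = col \<alpha>"
  proof (cases "col \<delta>" "col \<alpha>" rule: linorder_cases)
    case less
    then show ?thesis
      using *[of "col \<delta>"] assms by (simp add: root_vec_below_col root_vec_col)
  next
    case greater
    then show ?thesis
      using *[of "col \<alpha>"] assms by (simp add: root_vec_below_col root_vec_col)
  qed
  define a b c g where "a = row \<alpha>" "b = row \<gamma>" "c = row \<delta>" "g = col \<gamma>"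
  note defs = this
  have g: "1 \<le> g" "b = 0 \<or> int g < \<bar>b\<bar>"
    using pos_root_bounds[OF \<gamma>] by (auto simp: defs)
  have eq: "of_bool (a = - int k) - of_bool (a = int k) + of_bool (k = g)
      + (of_bool (b = - int k) - of_bool (b = int k)) = (of_bool (c = - int k) - of_bool (c = int k) :: real)"
    if "1 \<le> k" for k
    using *[of k] col unfolding root_vec_eq[OF \<alpha> that] root_vec_eq[OF \<gamma> that] root_vec_eq[OF \<delta> that]
    by (simp add: defs)
  \<comment> \<open>At coordinate g the column of \<gamma> contributes 1, and its own row
    contributes nothing there. This 1 is either cancelled by the row of \<alpha> or survives as the
    row of \<delta>.\<close>
  have "a = int g \<or> c = - int g"
    using eq[of g] g by (auto simp: of_bool_def split: if_splits)
  then show ?thesis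
  proof
    assume a: "a = int g"
    have "b = c"
    proof (rule row_eqI)
      fix k :: nat
      assume k: "1 \<le> k"
      have "of_bool (k = g) = (of_bool (a = int k) :: real)" "a \<noteq> - int k"
        using a k g by auto
      then show "(of_bool (b = - int k) - of_bool (b = int k) :: real) =
          of_bool (c = - int k) - of_bool (c = int k)"
        using eq[OF k] by simp
    qed
    then show ?thesis
      using a col unfolding root_sum_rel_def defs by simp
  next
    assume c: "c = - int g"
    have "a = - b"
    proof (rule row_eqI)
      fix k :: nat
      assume k: "1 \<le> k"
      have "of_bool (k = g) = (of_bool (c = - int k) :: real)" "c \<noteq> int k"
        using c k g by auto
      moreover have "- b = - int k \<longleftrightarrow> b = int k" "- b = int k \<longleftrightarrow> b = - int k"
        by auto
      ultimately show "(of_bool (a = - int k) - of_bool (a = int k) :: real) =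
          of_bool (- b = - int k) - of_bool (- b = int k)"
        using eq[OF k] by simp
    qed
    then show ?thesis
      using c col less unfolding root_sum_rel_def defs by simp
  qed
qed

lemma root_vec_add_imp_rel:
  assumes \<alpha>: "\<alpha> \<in> pos_roots \<Phi> n" and \<gamma>: "\<gamma> \<in> pos_roots \<Phi> n" and \<delta>: "\<delta> \<in> pos_roots \<Phi> n"
    and sum: "root_vec \<alpha> + root_vec \<gamma> = root_vec \<delta>"
  shows "root_sum_rel \<alpha> \<gamma> \<delta>"
proof (cases "col \<alpha>" "col \<gamma>" rule: linorder_cases)
  case less
  then show ?thesis
    by (rule root_vec_add_imp_rel_less[OF assms])
next
  \<comment> \<open>Equal columns are impossible: the sum would have coordinate 2 there.\<close>
  case equal
  have "root_vec \<alpha> (col \<alpha>) + root_vec \<gamma> (col \<alpha>) = root_vec \<delta> (col \<alpha>)"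
    using sum by (metis plus_fun_apply)
  moreover have "root_vec \<delta> (col \<alpha>) \<le> 1"
    using \<delta> by (auto simp: pos_roots_def std_basis_def split: if_splits)
  ultimately show ?thesis
    using root_vec_col[OF \<alpha>] root_vec_col[OF \<gamma>] equal by simp
next
  case greater
  have "root_vec \<gamma> + root_vec \<alpha> = root_vec \<delta>"
    using sum by (simp only: add.commute)
  then have "root_sum_rel \<gamma> \<alpha> \<delta>"
    using greater by (rule root_vec_add_imp_rel_less[OF \<gamma> \<alpha> \<delta>])
  then show ?thesis
    using root_sum_rel_commute by blast
qed

lemma root_sum_rel_imp_root_vec_add:
  assumes \<alpha>: "\<alpha> \<in> pos_roots \<Phi> n" and \<gamma>: "\<gamma> \<in> pos_roots \<Phi> n" and \<delta>: "\<delta> \<in> pos_roots \<Phi> n"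
    and rel: "root_sum_rel \<alpha> \<gamma> \<delta>"
  shows "root_vec \<alpha> + root_vec \<gamma> = root_vec \<delta>"
proof
  fix k
  show "(root_vec \<alpha> + root_vec \<gamma>) k = root_vec \<delta> k"
  proof (cases "1 \<le> k")
    case False
    then show ?thesis
      using pos_root_bounds(1)[OF \<alpha>] pos_root_bounds(1)[OF \<gamma>] pos_root_bounds(1)[OF \<delta>] assms
      by (simp add: root_vec_below_col)
  next
    case True
    have *: "(int m = - int k) = False" "(int m = int k) = (k = m)" for m
      using True by auto
    have "of_bool (k = col \<alpha>) + of_bool (row \<alpha> = - int k) - of_bool (row \<alpha> = int k) +
        (of_bool (k = col \<gamma>) + of_bool (row \<gamma> = - int k) - of_bool (row \<gamma> = int k)) =
        (of_bool (k = col \<delta>) + of_bool (row \<delta> = - int k) - of_bool (row \<delta> = int k) :: real)"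
      using rel[unfolded root_sum_rel_def]
    proof (elim disjE conjE)
      assume "row \<gamma> = int (col \<alpha>)" "row \<delta> = row \<alpha>" "col \<delta> = col \<gamma>"
      then show ?thesis
        by (simp only: *) simp
    next
      assume "row \<alpha> = int (col \<gamma>)" "row \<delta> = row \<gamma>" "col \<delta> = col \<alpha>"
      then show ?thesis
        by (simp only: *) simp
    next
      assume r: "row \<alpha> = - row \<gamma>" "col \<delta> = min (col \<alpha>) (col \<gamma>)"
        "row \<delta> = - int (max (col \<alpha>) (col \<gamma>))"
      have "row \<alpha> = int k \<longleftrightarrow> row \<gamma> = - int k" "row \<alpha> = - int k \<longleftrightarrow> row \<gamma> = int k"
        using r(1) by linarith+
      moreover have "row \<delta> \<noteq> int k" "row \<delta> = - int k \<longleftrightarrow> k = max (col \<alpha>) (col \<gamma>)"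
        using r(3) True by linarith+
      moreover have "of_bool (k = min (col \<alpha>) (col \<gamma>)) + of_bool (k = max (col \<alpha>) (col \<gamma>)) =
          (of_bool (k = col \<alpha>) + of_bool (k = col \<gamma>) :: real)"
        by (simp add: min_def max_def)
      ultimately show ?thesis
        using r(2) by simp
    qed
    then show ?thesis
      by (simp only: plus_fun_apply root_vec_eq[OF \<alpha> True] root_vec_eq[OF \<gamma> True] root_vec_eq[OF \<delta> True])
  qed
qed

text \<open>The cancellation conditions of \<open>root_sum_rel\<close> suffice: by the inequality
  between column and absolute row, the pair prescribed for \<delta> always meets the conditions of
  \<open>pos_root_exists\<close>.\<close>

lemma root_sum_exists:
  assumes \<alpha>: "\<alpha> \<in> pos_roots \<Phi> n" and \<gamma>: "\<gamma> \<in> pos_roots \<Phi> n"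
    and "row \<gamma> = int (col \<alpha>) \<or> row \<alpha> = int (col \<gamma>) \<or> row \<alpha> = - row \<gamma> \<and> col \<alpha> \<noteq> col \<gamma>"
  shows "\<exists>\<delta> \<in> pos_roots \<Phi> n. root_vec \<alpha> + root_vec \<gamma> = root_vec \<delta>"
proof -
  note b = pos_root_bounds[OF \<alpha>] pos_root_bounds[OF \<gamma>]
  have "\<exists>\<delta> \<in> pos_roots \<Phi> n. root_sum_rel \<alpha> \<gamma> \<delta>"
    using assms(3)
  proof (elim disjE)
    assume r: "row \<gamma> = int (col \<alpha>)"
    obtain \<delta> where "\<delta> \<in> pos_roots \<Phi> n" "row \<delta> = row \<alpha>" "col \<delta> = col \<gamma>"
      by (rule pos_root_exists[of "col \<gamma>" n "row \<alpha>" \<Phi>]) (use b r in linarith)+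
    then show ?thesis
      using r unfolding root_sum_rel_def by blast
  next
    assume r: "row \<alpha> = int (col \<gamma>)"
    obtain \<delta> where "\<delta> \<in> pos_roots \<Phi> n" "row \<delta> = row \<gamma>" "col \<delta> = col \<alpha>"
      by (rule pos_root_exists[of "col \<alpha>" n "row \<gamma>" \<Phi>]) (use b r in linarith)+
    then show ?thesis
      using r unfolding root_sum_rel_def by blast
  next
    assume r: "row \<alpha> = - row \<gamma> \<and> col \<alpha> \<noteq> col \<gamma>"
    obtain \<delta> where "\<delta> \<in> pos_roots \<Phi> n" "row \<delta> = - int (max (col \<alpha>) (col \<gamma>))"
      "col \<delta> = min (col \<alpha>) (col \<gamma>)"
      by (rule pos_root_exists[of "min (col \<alpha>) (col \<gamma>)" n "- int (max (col \<alpha>) (col \<gamma>))" \<Phi>])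
        (use b r in linarith)+
    then show ?thesis
      using r unfolding root_sum_rel_def by blast
  qed
  then show ?thesis
    using root_sum_rel_imp_root_vec_add[OF \<alpha> \<gamma>] by blast
qed

text \<open>Makes the splitting of a pair visible in the columns: the summand in
  \<open>singular_plus\<close> is the one with the smaller column.\<close>

lemma col_root_sum:
  assumes "\<alpha> \<in> pos_roots \<Phi> n" "\<gamma> \<in> pos_roots \<Phi> n" "\<delta> \<in> pos_roots \<Phi> n"
    and "root_vec \<alpha> + root_vec \<gamma> = root_vec \<delta>"
  shows "col \<delta> = min (col \<alpha>) (col \<gamma>)" "col \<alpha> \<noteq> col \<gamma>"
proof -
  have "col \<delta> = min (col \<alpha>) (col \<gamma>) \<and> col \<alpha> \<noteq> col \<gamma>"
    using root_vec_add_imp_rel[OF assms, unfolded root_sum_rel_def]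
  proof (elim disjE conjE)
    assume "row \<gamma> = int (col \<alpha>)" "col \<delta> = col \<gamma>"
    then show ?thesis
      using pos_root_bounds(1)[OF assms(1)] pos_root_bounds(4)[OF assms(2)] by linarith
  next
    assume "row \<alpha> = int (col \<gamma>)" "col \<delta> = col \<alpha>"
    then show ?thesis
      using pos_root_bounds(1)[OF assms(2)] pos_root_bounds(4)[OF assms(1)] by linarith
  qed simp
  then show "col \<delta> = min (col \<alpha>) (col \<gamma>)" "col \<alpha> \<noteq> col \<gamma>"
    by auto
qed

lemma root_vec_inj:
  assumes \<alpha>: "\<alpha> \<in> pos_roots \<Phi> n" and \<beta>: "\<beta> \<in> pos_roots \<Phi> n"
    and eq: "root_vec \<alpha> = root_vec \<beta>"
  shows "\<alpha> = \<beta>"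
proof (rule pos_root_eqI[OF \<alpha> \<beta>])
  show col: "col \<alpha> = col \<beta>"
    using root_vec_below_col[OF \<alpha>] root_vec_below_col[OF \<beta>] root_vec_col[OF \<alpha>] root_vec_col[OF \<beta>] eq
    by (metis linorder_neqE_nat zero_neq_one)
  show "row \<alpha> = row \<beta>"
  proof (rule row_eqI)
    fix k :: nat
    assume "1 \<le> k"
    then show "(of_bool (row \<alpha> = - int k) - of_bool (row \<alpha> = int k) :: real) =
        of_bool (row \<beta> = - int k) - of_bool (row \<beta> = int k)"
      using root_vec_eq[OF \<alpha>, of k] root_vec_eq[OF \<beta>, of k] eq col by simp
  qed
qed

text \<open>The row and column of \<alpha> + \<gamma> are, up to sign, taken from rows and columns
  of \<alpha> and \<gamma>. A cancellation of \<eta> against the sum is therefore one against a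
  summand.\<close>

lemma root_sum_three:
  assumes \<alpha>: "\<alpha> \<in> pos_roots \<Phi> n" and \<gamma>: "\<gamma> \<in> pos_roots \<Phi> n" and \<eta>: "\<eta> \<in> pos_roots \<Phi> n"
    and \<delta>: "\<delta> \<in> pos_roots \<Phi> n" and \<beta>: "\<beta> \<in> pos_roots \<Phi> n"
    and "root_vec \<alpha> + root_vec \<gamma> = root_vec \<delta>" "root_vec \<eta> + root_vec \<delta> = root_vec \<beta>"
  shows "(\<exists>\<zeta> \<in> pos_roots \<Phi> n. root_vec \<eta> + root_vec \<alpha> = root_vec \<zeta>) \<or>
    (\<exists>\<zeta> \<in> pos_roots \<Phi> n. root_vec \<eta> + root_vec \<gamma> = root_vec \<zeta>)"
proof -
  have eta: "row \<delta> = int (col \<eta>) \<or> row \<eta> = int (col \<delta>) \<or> row \<eta> = - row \<delta> \<and> col \<eta> \<noteq> col \<delta>"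
    using root_vec_add_imp_rel[OF \<eta> \<delta> \<beta> assms(7)] unfolding root_sum_rel_def by blast
  have "row \<alpha> = int (col \<eta>) \<or> row \<eta> = int (col \<alpha>) \<or> row \<eta> = - row \<alpha> \<and> col \<eta> \<noteq> col \<alpha> \<or>
    row \<gamma> = int (col \<eta>) \<or> row \<eta> = int (col \<gamma>) \<or> row \<eta> = - row \<gamma> \<and> col \<eta> \<noteq> col \<gamma>"
    using root_vec_add_imp_rel[OF \<alpha> \<gamma> \<delta> assms(6), unfolded root_sum_rel_def]
  proof (elim disjE conjE)
    assume r: "row \<gamma> = int (col \<alpha>)" "row \<delta> = row \<alpha>" "col \<delta> = col \<gamma>"
    \<comment> \<open>If \<eta> cancels the row inherited from \<alpha> but shares the column of
      \<alpha>, then \<open>row \<gamma> = int (col \<eta>)\<close>, so \<eta> + \<gamma> is the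
      root instead. The next case is symmetric.\<close>
    show ?thesis
      using eta unfolding r by (elim disjE conjE) (auto simp: r)
  next
    assume r: "row \<alpha> = int (col \<gamma>)" "row \<delta> = row \<gamma>" "col \<delta> = col \<alpha>"
    show ?thesis
      using eta unfolding r by (elim disjE conjE) (auto simp: r)
  next
    assume r: "row \<alpha> = - row \<gamma>" "col \<delta> = min (col \<alpha>) (col \<gamma>)"
      "row \<delta> = - int (max (col \<alpha>) (col \<gamma>))"
    \<comment> \<open>A negative row of \<delta> cannot equal the column of \<eta>, and
      \<open>row \<eta> = - row \<delta>\<close> says that the row of \<eta> is the column of
      \<alpha> or of \<gamma>.\<close>
    have "row \<delta> < 0" "row \<delta> = - int (col \<alpha>) \<or> row \<delta> = - int (col \<gamma>)"
      "col \<delta> = col \<alpha> \<or> col \<delta> = col \<gamma>"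
      using pos_root_bounds(1)[OF \<alpha>] unfolding r by (auto simp: max_def min_def)
    then show ?thesis
      using eta by (elim disjE) auto
  qed
  then show ?thesis
    using root_sum_exists[OF \<eta> \<alpha>] root_sum_exists[OF \<eta> \<gamma>] by blast
qed

section \<open>The battleship map followed step by step along a list of roots\<close>

section \<open>The roots marked Minus\<close>

text \<open>The list of processed roots is a parameter, so that induction on its last entry follows
  the steps.\<close>

definition minus_set :: "root_type \<Rightarrow> nat \<Rightarrow> root set \<Rightarrow> root list \<Rightarrow> root set" where
  "minus_set \<Phi> n D bs =
     {\<alpha>. fold (battleship_step \<Phi> n) bs (battleship_init D) \<alpha> = Some Minus}"

lemma minus_set_Nil: "minus_set \<Phi> n D [] = {}"
  by (auto simp: minus_set_def battleship_init_def)

text \<open>A mark \<open>Minus\<close> is never overwritten, because admissible pairs avoid such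
  roots, and within one step \<open>Plus\<close> and \<open>Minus\<close> go to disjoint sets. Hence
  the set evolves without reference to the other marks.\<close>

lemma minus_set_snoc:
  "minus_set \<Phi> n D (bs @ [\<beta>]) = minus_set \<Phi> n D bs \<union>
     {\<delta>. \<exists>\<gamma>. \<gamma> \<in> singular_plus \<Phi> n \<beta> \<and> \<delta> \<in> singular_minus \<Phi> n \<beta> \<and>
       root_vec \<gamma> + root_vec \<delta> = root_vec \<beta> \<and>
       \<gamma> \<notin> minus_set \<Phi> n D bs \<and> \<delta> \<notin> minus_set \<Phi> n D bs}"
  by (auto simp: minus_set_def battleship_step_def admissible_pair_def singular_minus_def)

lemma singular_pair:
  assumes \<gamma>: "\<gamma> \<in> pos_roots \<Phi> n" and \<delta>: "\<delta> \<in> pos_roots \<Phi> n" and \<beta>: "\<beta> \<in> pos_roots \<Phi> n"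
    and sum: "root_vec \<gamma> + root_vec \<delta> = root_vec \<beta>" and less: "col \<gamma> < col \<delta>"
  shows "\<gamma> \<in> singular_plus \<Phi> n \<beta>" "\<delta> \<in> singular_minus \<Phi> n \<beta>"
proof -
  have "col \<beta> = col \<gamma>"
    using col_root_sum(1)[OF \<gamma> \<delta> \<beta> sum] less by simp
  moreover have "root_vec \<delta> + root_vec \<gamma> = root_vec \<beta>"
    using sum by (simp only: add.commute)
  ultimately show "\<gamma> \<in> singular_plus \<Phi> n \<beta>" "\<delta> \<in> singular_minus \<Phi> n \<beta>"
    using assms unfolding singular_plus_def singular_minus_def singular_def by auto
qed

lemma singular_pairD:
  assumes "\<gamma> \<in> singular_plus \<Phi> n \<beta>" "\<delta> \<in> singular_minus \<Phi> n \<beta>"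
    and \<beta>: "\<beta> \<in> pos_roots \<Phi> n" and sum: "root_vec \<gamma> + root_vec \<delta> = root_vec \<beta>"
  shows "\<gamma> \<in> pos_roots \<Phi> n" "\<delta> \<in> pos_roots \<Phi> n" "col \<gamma> = col \<beta>" "col \<beta> < col \<delta>"
proof -
  show \<gamma>: "\<gamma> \<in> pos_roots \<Phi> n" and \<delta>: "\<delta> \<in> pos_roots \<Phi> n" and "col \<gamma> = col \<beta>"
    using assms(1,2) by (auto simp: singular_plus_def singular_minus_def singular_def)
  then show "col \<beta> < col \<delta>"
    using col_root_sum[OF \<gamma> \<delta> \<beta> sum] by simp
qed

text \<open>If neither summand was marked before, the pair is admissible and the step marks the
  summand with the larger column.\<close>

lemma minus_set_step:
  assumes \<gamma>: "\<gamma> \<in> pos_roots \<Phi> n" and \<delta>: "\<delta> \<in> pos_roots \<Phi> n" and \<beta>: "\<beta> \<in> pos_roots \<Phi> n"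
    and sum: "root_vec \<gamma> + root_vec \<delta> = root_vec \<beta>"
  shows "\<gamma> \<in> minus_set \<Phi> n D (bs @ [\<beta>]) \<or> \<delta> \<in> minus_set \<Phi> n D (bs @ [\<beta>])"
proof -
  have sum': "root_vec \<delta> + root_vec \<gamma> = root_vec \<beta>"
    using sum by (simp only: add.commute)
  have "col \<gamma> < col \<delta> \<or> col \<delta> < col \<gamma>"
    using col_root_sum(2)[OF \<gamma> \<delta> \<beta> sum] by linarith
  then show ?thesis
    using singular_pair[OF \<gamma> \<delta> \<beta> sum] singular_pair[OF \<delta> \<gamma> \<beta> sum'] sum sum'
    unfolding minus_set_snoc by blast
qed

lemma minus_set_mono: "minus_set \<Phi> n D bs \<subseteq> minus_set \<Phi> n D (bs @ cs)"
proof (induction cs rule: rev_induct)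
  case (snoc c cs)
  then show ?case
    unfolding append_assoc[symmetric] minus_set_snoc by blast
qed simp

lemma minus_set_sum:
  assumes "\<gamma> \<in> pos_roots \<Phi> n" "\<delta> \<in> pos_roots \<Phi> n" "\<beta> \<in> pos_roots \<Phi> n"
    and "root_vec \<gamma> + root_vec \<delta> = root_vec \<beta>" "\<beta> \<in> set bs"
  shows "\<gamma> \<in> minus_set \<Phi> n D bs \<or> \<delta> \<in> minus_set \<Phi> n D bs"
proof -
  obtain as cs where bs: "bs = (as @ [\<beta>]) @ cs"
    using split_list[OF assms(5)] by auto
  show ?thesis
    using minus_set_step[OF assms(1-4), of D as] minus_set_mono[of \<Phi> n D "as @ [\<beta>]" cs]
    unfolding bs by blast
qed

text \<open>
  If \<open>\<alpha> + \<gamma>\<close> were marked at the step of \<open>\<beta> = \<eta> + (\<alpha> + \<gamma>)\<close>, then one of \<open>\<eta> + \<alpha>\<close>, \<open>\<eta> + \<gamma>\<close>,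
  say the first, is a root. By induction it is unmarked before this step, so the step would have
  marked \<open>\<eta> + \<alpha>\<close> or \<open>\<gamma>\<close>, and it is \<open>\<gamma>\<close> since its column exceeds that of \<open>\<beta>\<close>.
\<close>
lemma minus_set_complement_closed:
  assumes "set bs \<subseteq> pos_roots \<Phi> n"
    and "\<alpha> \<in> pos_roots \<Phi> n" "\<gamma> \<in> pos_roots \<Phi> n" "\<delta> \<in> pos_roots \<Phi> n"
    and "root_vec \<alpha> + root_vec \<gamma> = root_vec \<delta>"
    and "\<alpha> \<notin> minus_set \<Phi> n D bs" "\<gamma> \<notin> minus_set \<Phi> n D bs"
  shows "\<delta> \<notin> minus_set \<Phi> n D bs"
  using assms
proof (induction bs arbitrary: \<alpha> \<gamma> \<delta> rule: rev_induct)
  case Nil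
  then show ?case
    by (simp add: minus_set_Nil)
next
  case (snoc \<beta> bs)
  let ?M = "minus_set \<Phi> n D bs"
  have \<beta>: "\<beta> \<in> pos_roots \<Phi> n"
    using snoc.prems(1) by simp
  have IH: "\<delta>' \<notin> ?M" if "\<alpha>' \<in> pos_roots \<Phi> n" "\<gamma>' \<in> pos_roots \<Phi> n" "\<delta>' \<in> pos_roots \<Phi> n"
    "root_vec \<alpha>' + root_vec \<gamma>' = root_vec \<delta>'" "\<alpha>' \<notin> ?M" "\<gamma>' \<notin> ?M" for \<alpha>' \<gamma>' \<delta>'
    using snoc.IH[OF _ that] snoc.prems(1) by simp
  \<comment> \<open>Stated for fresh roots because it is used twice, with \<alpha> and \<gamma>
    interchanged.\<close>
  have key: False
    if \<alpha>: "\<alpha> \<in> pos_roots \<Phi> n" "\<alpha> \<notin> minus_set \<Phi> n D (bs @ [\<beta>])"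
      and \<gamma>: "\<gamma> \<in> pos_roots \<Phi> n" "\<gamma> \<notin> minus_set \<Phi> n D (bs @ [\<beta>])"
      and \<eta>: "\<eta> \<in> pos_roots \<Phi> n" "\<eta> \<notin> ?M"
      and \<zeta>: "\<zeta> \<in> pos_roots \<Phi> n" "root_vec \<eta> + root_vec \<alpha> = root_vec \<zeta>"
      and sum: "root_vec \<eta> + (root_vec \<alpha> + root_vec \<gamma>) = root_vec \<beta>"
      and col: "col \<beta> < col \<gamma>"
    for \<alpha> \<gamma> \<eta> \<zeta>
  proof -
    have "\<alpha> \<notin> ?M" and \<gamma>M: "\<gamma> \<notin> ?M"
      using \<alpha>(2) \<gamma>(2) unfolding minus_set_snoc by auto
    then have \<zeta>M: "\<zeta> \<notin> ?M"
      using IH[OF \<eta>(1) \<alpha>(1) \<zeta>(1,2) \<eta>(2)] by simp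
    have sum': "root_vec \<zeta> + root_vec \<gamma> = root_vec \<beta>"
      using sum unfolding \<zeta>(2)[symmetric] by (simp only: add.assoc)
    have "col \<zeta> < col \<gamma>"
      using col_root_sum(1)[OF \<zeta>(1) \<gamma>(1) \<beta> sum'] col by linarith
    then show False
      using singular_pair[OF \<zeta>(1) \<gamma>(1) \<beta> sum'] sum' \<zeta>M \<gamma>M \<gamma>(2) unfolding minus_set_snoc by blast
  qed
  show ?case
  proof
    assume "\<delta> \<in> minus_set \<Phi> n D (bs @ [\<beta>])"
    moreover have "\<delta> \<notin> ?M"
      using IH[OF snoc.prems(2-5)] snoc.prems(6,7) unfolding minus_set_snoc by blast
    ultimately obtain \<eta> where \<eta>: "\<eta> \<in> singular_plus \<Phi> n \<beta>" "\<delta> \<in> singular_minus \<Phi> n \<beta>"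
      "root_vec \<eta> + root_vec \<delta> = root_vec \<beta>" "\<eta> \<notin> ?M"
      unfolding minus_set_snoc by blast
    note \<eta>\<delta> = singular_pairD[OF \<eta>(1,2) \<beta> \<eta>(3)]
    \<comment> \<open>The column of \<delta> is the minimum of these two columns and already exceeds
      that of \<beta>.\<close>
    have col: "col \<beta> < col \<alpha>" "col \<beta> < col \<gamma>"
      using col_root_sum(1)[OF snoc.prems(2-5)] \<eta>\<delta>(4) by linarith+
    have sum: "root_vec \<eta> + (root_vec \<alpha> + root_vec \<gamma>) = root_vec \<beta>"
      unfolding snoc.prems(5) by (rule \<eta>(3))
    then have sum': "root_vec \<eta> + (root_vec \<gamma> + root_vec \<alpha>) = root_vec \<beta>"
      by (simp only: add.commute)
    from root_sum_three[OF snoc.prems(2,3) \<eta>\<delta>(1) snoc.prems(4) \<beta> snoc.prems(5) \<eta>(3)]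
    show False
      using key[OF snoc.prems(2,6,3,7) \<eta>\<delta>(1) \<eta>(4) _ _ sum col(2)]
        key[OF snoc.prems(3,7,2,6) \<eta>\<delta>(1) \<eta>(4) _ _ sum' col(1)] by blast
  qed
qed

text \<open>Here the processing order matters. The partner \<gamma> is unmarked when \<delta> gets
  its mark and lies in the column of \<beta>; later steps only mark roots in columns to the right of
  their own, hence never \<gamma>.\<close>

lemma minus_set_partner:
  assumes "sorted (map col bs)" "set bs \<subseteq> pos_roots \<Phi> n" "\<delta> \<in> minus_set \<Phi> n D bs"
  obtains \<beta> \<gamma> where "\<beta> \<in> set bs" "\<gamma> \<in> pos_roots \<Phi> n" "\<delta> \<in> pos_roots \<Phi> n"
    "\<gamma> \<notin> minus_set \<Phi> n D bs" "root_vec \<gamma> + root_vec \<delta> = root_vec \<beta>"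
    "col \<gamma> = col \<beta>" "col \<beta> < col \<delta>"
proof -
  have "\<exists>\<beta> \<gamma>. \<beta> \<in> set bs \<and> \<gamma> \<in> pos_roots \<Phi> n \<and> \<delta> \<in> pos_roots \<Phi> n \<and>
    \<gamma> \<notin> minus_set \<Phi> n D bs \<and> root_vec \<gamma> + root_vec \<delta> = root_vec \<beta> \<and>
    col \<gamma> = col \<beta> \<and> col \<beta> < col \<delta>"
    using assms
  proof (induction bs rule: rev_induct)
    case Nil
    then show ?case
      by (simp add: minus_set_Nil)
  next
    case (snoc \<beta> bs)
    let ?M = "minus_set \<Phi> n D bs"
    have \<beta>: "\<beta> \<in> pos_roots \<Phi> n"
      using snoc.prems(2) by simp
    \<comment> \<open>The step of \<beta> adds only roots whose column exceeds
      \<open>col \<beta>\<close>.\<close>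
    have new: "\<gamma> \<in> ?M" if "col \<gamma> \<le> col \<beta>" "\<gamma> \<in> minus_set \<Phi> n D (bs @ [\<beta>])" for \<gamma>
      using that singular_pairD(4)[OF _ _ \<beta>] unfolding minus_set_snoc by fastforce
    show ?case
    proof (cases "\<delta> \<in> ?M")
      case True
      then obtain \<beta>' \<gamma> where *: "\<beta>' \<in> set bs" "\<gamma> \<in> pos_roots \<Phi> n" "\<delta> \<in> pos_roots \<Phi> n"
        "\<gamma> \<notin> ?M" "root_vec \<gamma> + root_vec \<delta> = root_vec \<beta>'" "col \<gamma> = col \<beta>'" "col \<beta>' < col \<delta>"
        using snoc.IH snoc.prems(1,2) unfolding map_append sorted_append set_append by blast
      have "col \<gamma> \<le> col \<beta>"
        using snoc.prems(1) *(1,6) by (auto simp: sorted_append)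
      then have "\<gamma> \<notin> minus_set \<Phi> n D (bs @ [\<beta>])"
        using new *(4) by blast
      then show ?thesis
        using * unfolding set_append by blast
    next
      case False
      then obtain \<gamma> where \<gamma>: "\<gamma> \<in> singular_plus \<Phi> n \<beta>" "\<delta> \<in> singular_minus \<Phi> n \<beta>"
        "root_vec \<gamma> + root_vec \<delta> = root_vec \<beta>" "\<gamma> \<notin> ?M"
        using snoc.prems(3) unfolding minus_set_snoc by blast
      note \<gamma>\<delta> = singular_pairD[OF \<gamma>(1,2) \<beta> \<gamma>(3)]
      have "\<gamma> \<notin> minus_set \<Phi> n D (bs @ [\<beta>])"
        using new[of \<gamma>] \<gamma>(4) \<gamma>\<delta>(3) by auto
      then show ?thesis
        using \<gamma>(3) \<gamma>\<delta> unfolding set_append by fastforce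
    qed
  qed
  then show thesis
    using that by blast
qed

section \<open>From lists of processed roots to the placement D and \<open>P_set\<close>\<close>

lemma P_set_eq:
  "P_set \<Phi> n D = pos_roots \<Phi> n - minus_set \<Phi> n D (sorted_key_list_of_set col D)"
  by (auto simp: P_set_def battleship_def minus_set_def split: option.splits)

lemma orthogonal_rook_placement_inj_on_col:
  assumes "orthogonal_rook_placement \<Phi> n D"
  shows "inj_on col D"
proof (rule inj_onI)
  fix \<alpha> \<beta>
  assume *: "\<alpha> \<in> D" "\<beta> \<in> D" "col \<alpha> = col \<beta>"
  have D: "D \<subseteq> pos_roots \<Phi> n"
    using assms by (simp add: orthogonal_rook_placement_def)
  then have "col \<alpha> \<in> {1..n}"
    using *(1) pos_root_bounds(1,2) by auto
  then have "card (D \<inter> root_col \<Phi> n (col \<alpha>)) \<le> 1"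
    using assms by (simp add: orthogonal_rook_placement_def)
  moreover have "finite (D \<inter> root_col \<Phi> n (col \<alpha>))"
    using D finite_pos_roots finite_subset by blast
  moreover have "\<alpha> \<in> D \<inter> root_col \<Phi> n (col \<alpha>)" "\<beta> \<in> D \<inter> root_col \<Phi> n (col \<alpha>)"
    using * D by (auto simp: root_col_def)
  ultimately show "\<alpha> = \<beta>"
    unfolding One_nat_def using card_le_Suc0_iff_eq by blast
qed

lemma sorted_key_list_of_set_col:
  assumes "orthogonal_rook_placement \<Phi> n D"
  shows "set (sorted_key_list_of_set col D) = D"
    and "sorted (map col (sorted_key_list_of_set col D))"
proof -
  have "finite D"
    using assms finite_pos_roots finite_subset by (auto simp: orthogonal_rook_placement_def)
  \<comment> \<open>Insertions of distinct roots with the same column need not commute, so the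
    folding is restricted to D, where \<open>col\<close> is injective.\<close>
  have comm: "folding_on D (insort_key col)"
  proof
    fix \<alpha> \<beta>
    assume "\<alpha> \<in> D" "\<beta> \<in> D"
    then show "insort_key col \<beta> \<circ> insort_key col \<alpha> = insort_key col \<alpha> \<circ> insort_key col \<beta>"
      using orthogonal_rook_placement_inj_on_col[OF assms] insort_key_left_comm[of col \<alpha> \<beta>]
      by (cases "\<alpha> = \<beta>") (auto simp: fun_eq_iff inj_on_def)
  qed
  have "set (sorted_key_list_of_set col A) = A \<and> sorted (map col (sorted_key_list_of_set col A))"
    if "A \<subseteq> D" for A
    using finite_subset[OF that \<open>finite D\<close>] that
  proof (induction A rule: finite_induct)
    case empty
    then show ?case
      by (simp add: sorted_key_list_of_set_def folding_on.empty[OF comm])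
  next
    case (insert \<alpha> A)
    then have "sorted_key_list_of_set col (insert \<alpha> A) =
        insort_key col \<alpha> (sorted_key_list_of_set col A)"
      unfolding sorted_key_list_of_set_def by (intro folding_on.insert[OF comm]) auto
    then show ?case
      using insert by (simp add: set_insort_key sorted_insort_key)
  qed
  then show "set (sorted_key_list_of_set col D) = D"
    and "sorted (map col (sorted_key_list_of_set col D))"
    by auto
qed

text \<open>The two conclusions are the root-level forms of closure under the bracket and of
  isotropy. The second holds because the step of a root of D marks a member of each pair summing to
  it.\<close>

lemma P_set_closed:
  assumes D: "orthogonal_rook_placement \<Phi> n D"
    and "\<alpha> \<in> P_set \<Phi> n D" "\<gamma> \<in> P_set \<Phi> n D" "\<delta> \<in> pos_roots \<Phi> n"
    and "root_vec \<alpha> + root_vec \<gamma> = root_vec \<delta>"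
  shows "\<delta> \<in> P_set \<Phi> n D" "\<delta> \<notin> D"
proof -
  note bs = sorted_key_list_of_set_col(1)[OF D]
  have "D \<subseteq> pos_roots \<Phi> n"
    using D by (simp add: orthogonal_rook_placement_def)
  then show "\<delta> \<in> P_set \<Phi> n D"
    using assms(2-5) bs minus_set_complement_closed[of "sorted_key_list_of_set col D" \<Phi> n \<alpha> \<gamma> \<delta> D]
    unfolding P_set_eq by auto
  show "\<delta> \<notin> D"
    using assms(2-5) bs minus_set_sum[of \<alpha> \<Phi> n \<gamma> \<delta> "sorted_key_list_of_set col D" D]
    unfolding P_set_eq by auto
qed

lemma P_set_partner:
  assumes D: "orthogonal_rook_placement \<Phi> n D"
    and "\<delta> \<in> pos_roots \<Phi> n" "\<delta> \<notin> P_set \<Phi> n D"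
  obtains \<beta> \<gamma> where "\<beta> \<in> D" "\<gamma> \<in> P_set \<Phi> n D" "root_vec \<gamma> + root_vec \<delta> = root_vec \<beta>"
    "col \<gamma> = col \<beta>" "col \<beta> < col \<delta>"
proof -
  note bs = sorted_key_list_of_set_col[OF D]
  have "set (sorted_key_list_of_set col D) \<subseteq> pos_roots \<Phi> n"
    using D bs(1) by (simp add: orthogonal_rook_placement_def)
  moreover have "\<delta> \<in> minus_set \<Phi> n D (sorted_key_list_of_set col D)"
    using assms(2,3) unfolding P_set_eq by blast
  ultimately show thesis
    using minus_set_partner[OF bs(2)] bs(1) that unfolding P_set_eq by (metis Diff_iff)
qed

section \<open>Structure constants in the root basis, and extension by bilinearity\<close>

section \<open>The bracket of root vectors\<close>

text \<open>Generators of the orthogonal Lie algebra of the symmetric form pairing index a with -a.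
  They treat the three kinds of root vectors uniformly.\<close>

definition skew_mat :: "int \<Rightarrow> int \<Rightarrow> 'a::field matrix" where
  "skew_mat a b = elem_mat a b - elem_mat (- b) (- a)"

lemma root_mat_eq_skew: "root_mat \<alpha> = skew_mat (row \<alpha>) (int (col \<alpha>))"
  by (cases \<alpha>) (simp_all add: skew_mat_def)

lemma finite_mat_index: "finite (mat_index \<Phi> n)"
  by (simp add: mat_index_def)

lemma uminus_mem_mat_index: "- a \<in> mat_index \<Phi> n \<longleftrightarrow> a \<in> mat_index \<Phi> n"
  by (auto simp: mat_index_def)

lemma mat_mult_elem_mat:
  assumes "b \<in> mat_index \<Phi> n"
  shows "mat_mult \<Phi> n (elem_mat a b) (elem_mat c d) = (if b = c then elem_mat a d else 0)"
proof (intro ext)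
  fix r s
  have "mat_mult \<Phi> n (elem_mat a b) (elem_mat c d) r s =
      (\<Sum>k\<in>mat_index \<Phi> n. if k = b then (if r = a \<and> b = c \<and> s = d then 1 else 0 :: 'a) else 0)"
    unfolding mat_mult_def elem_mat_def by (intro sum.cong) auto
  also have "\<dots> = (if r = a \<and> b = c \<and> s = d then 1 else 0)"
    using assms finite_mat_index by simp
  finally show "mat_mult \<Phi> n (elem_mat a b) (elem_mat c d) r s =
      (if b = c then elem_mat a d else 0 :: 'a matrix) r s"
    by (simp add: elem_mat_def)
qed

lemma mat_mult_diff_left: "mat_mult \<Phi> n (A - B) C = mat_mult \<Phi> n A C - mat_mult \<Phi> n B C"
  by (simp add: mat_mult_def fun_eq_iff left_diff_distrib sum_subtractf)

lemma mat_mult_diff_right: "mat_mult \<Phi> n A (B - C) = mat_mult \<Phi> n A B - mat_mult \<Phi> n A C"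
  by (simp add: mat_mult_def fun_eq_iff right_diff_distrib sum_subtractf)

lemma mat_mult_add_left: "mat_mult \<Phi> n (A + B) C = mat_mult \<Phi> n A C + mat_mult \<Phi> n B C"
  by (simp add: mat_mult_def fun_eq_iff distrib_right sum.distrib)

lemma mat_mult_add_right: "mat_mult \<Phi> n A (B + C) = mat_mult \<Phi> n A B + mat_mult \<Phi> n A C"
  by (simp add: mat_mult_def fun_eq_iff distrib_left sum.distrib)

lemma mat_mult_scale_left: "mat_mult \<Phi> n (mat_scale c A) B = mat_scale c (mat_mult \<Phi> n A B)"
  by (simp add: mat_mult_def mat_scale_def fun_eq_iff sum_distrib_left mult.assoc)

lemma mat_mult_scale_right: "mat_mult \<Phi> n A (mat_scale c B) = mat_scale c (mat_mult \<Phi> n A B)"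
  by (simp add: mat_mult_def mat_scale_def fun_eq_iff sum_distrib_left mult.left_commute)

lemma linear_bracket_right: "Vector_Spaces.linear mat_scale mat_scale (bracket \<Phi> n A)"
proof unfold_locales
  show "bracket \<Phi> n A (B + C) = bracket \<Phi> n A B + bracket \<Phi> n A C" for B C
    by (simp add: bracket_def mat_mult_add_left mat_mult_add_right)
  show "bracket \<Phi> n A (mat_scale c B) = mat_scale c (bracket \<Phi> n A B)" for c B
    by (simp add: bracket_def mat_mult_scale_left mat_mult_scale_right mat.scale_right_diff_distrib)
qed

lemma linear_bracket_left: "Vector_Spaces.linear mat_scale mat_scale (\<lambda>A. bracket \<Phi> n A B)"
proof unfold_locales
  show "bracket \<Phi> n (A + C) B = bracket \<Phi> n A B + bracket \<Phi> n C B" for A C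
    by (simp add: bracket_def mat_mult_add_left mat_mult_add_right)
  show "bracket \<Phi> n (mat_scale c A) B = mat_scale c (bracket \<Phi> n A B)" for c A
    by (simp add: bracket_def mat_mult_scale_left mat_mult_scale_right mat.scale_right_diff_distrib)
qed

text \<open>Of the eight products of elementary matrices, \<open>b \<noteq> - d\<close> kills two;
  the other six combine in pairs, one pair for each index coincidence.\<close>

lemma bracket_skew_mat:
  assumes "a \<in> mat_index \<Phi> n" "b \<in> mat_index \<Phi> n" "c \<in> mat_index \<Phi> n" "d \<in> mat_index \<Phi> n"
    and "b \<noteq> - d"
  shows "bracket \<Phi> n (skew_mat a b) (skew_mat c d) =
    (if c = b then skew_mat a d else 0) - (if a = d then skew_mat c b else 0)
      - (if a = - c then skew_mat (- b) d else 0)"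
proof -
  have *: "- a = - d \<longleftrightarrow> a = d" "- c = - b \<longleftrightarrow> c = b" "- a = c \<longleftrightarrow> a = - c" "- c = a \<longleftrightarrow> a = - c"
    "b = c \<longleftrightarrow> c = b" "d = a \<longleftrightarrow> a = d" "(d = - b) = False" "(b = - d) = False"
    using assms(5) by auto
  have collect: "(if P then e1 else 0) - (if R then e2 else 0) - (0 - (if Q then e3 else 0)) -
      ((if Q then e4 else 0) - (if R then e5 else 0) - (0 - (if P then e6 else 0))) =
      (if P then e1 - e6 else 0) - (if Q then e4 - e3 else 0) - (if R then e2 - e5 else 0)"
    for P Q R and e1 e2 e3 e4 e5 e6 :: "'a matrix"
    by (cases P; cases Q; cases R) (simp_all add: algebra_simps)
  show ?thesis
    unfolding bracket_def skew_mat_def mat_mult_diff_left mat_mult_diff_right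
    using assms(1-4) by (simp only: mat_mult_elem_mat uminus_mem_mat_index * if_False minus_minus collect)
qed

text \<open>Bilinearity, one argument at a time: the preimage of S under each partial map is a
  subspace containing the generators.\<close>

lemma bracket_span_in_subspace:
  assumes S: "mat.subspace S" and "\<And>a b. a \<in> A \<Longrightarrow> b \<in> B \<Longrightarrow> bracket \<Phi> n a b \<in> S"
    and x: "x \<in> mat.span A" and y: "y \<in> mat.span B"
  shows "bracket \<Phi> n x y \<in> S"
proof -
  have right: "bracket \<Phi> n a y \<in> S" if "a \<in> A" for a
  proof -
    interpret b: Vector_Spaces.linear mat_scale mat_scale "bracket \<Phi> n a"
      by (rule linear_bracket_right)
    have "mat.span B \<subseteq> bracket \<Phi> n a -` S"
      using assms(2) that by (intro mat.span_minimal b.subspace_vimage S) auto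
    then show ?thesis
      using y by auto
  qed
  interpret b: Vector_Spaces.linear mat_scale mat_scale "\<lambda>a. bracket \<Phi> n a y"
    by (rule linear_bracket_left)
  have "mat.span A \<subseteq> (\<lambda>a. bracket \<Phi> n a y) -` S"
    using right by (intro mat.span_minimal b.subspace_vimage S) auto
  then show ?thesis
    using x by auto
qed

lemma row_col_mem_mat_index:
  assumes "\<alpha> \<in> pos_roots \<Phi> n"
  shows "row \<alpha> \<in> mat_index \<Phi> n" "int (col \<alpha>) \<in> mat_index \<Phi> n"
  using pos_root_bounds[OF assms] by (auto simp: mat_index_def)

text \<open>The three terms match the three alternatives of \<open>root_sum_rel\<close>. Columns are
  positive, which supplies the inequality needed in \<open>bracket_skew_mat\<close>.\<close>

lemma bracket_root_mat:
  assumes \<alpha>: "\<alpha> \<in> pos_roots \<Phi> n" and \<gamma>: "\<gamma> \<in> pos_roots \<Phi> n"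
  shows "bracket \<Phi> n (root_mat \<alpha>) (root_mat \<gamma>) =
    (if row \<gamma> = int (col \<alpha>) then skew_mat (row \<alpha>) (int (col \<gamma>)) else 0)
      - (if row \<alpha> = int (col \<gamma>) then skew_mat (row \<gamma>) (int (col \<alpha>)) else 0)
      - (if row \<alpha> = - row \<gamma> then skew_mat (- int (col \<alpha>)) (int (col \<gamma>)) else 0)"
proof -
  have "int (col \<alpha>) \<noteq> - int (col \<gamma>)"
    using pos_root_bounds(1)[OF \<alpha>] by linarith
  then show ?thesis
    unfolding root_mat_eq_skew
    by (intro bracket_skew_mat row_col_mem_mat_index \<alpha> \<gamma>)
qed

lemma skew_mat_commute: "skew_mat (- a) b = - skew_mat (- b) a"
  by (simp add: skew_mat_def)

text \<open>Exactly one of the three terms survives. The sign is left open, since only membership in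
  subspaces and non-vanishing are needed later.\<close>

lemma bracket_root_mat_sum:
  assumes \<alpha>: "\<alpha> \<in> pos_roots \<Phi> n" and \<gamma>: "\<gamma> \<in> pos_roots \<Phi> n" and \<delta>: "\<delta> \<in> pos_roots \<Phi> n"
    and sum: "root_vec \<alpha> + root_vec \<gamma> = root_vec \<delta>"
  shows "bracket \<Phi> n (root_mat \<alpha>) (root_mat \<gamma>) \<in> {root_mat \<delta>, - (root_mat \<delta> :: 'a::field matrix)}"
  using root_vec_add_imp_rel[OF \<alpha> \<gamma> \<delta> sum, unfolded root_sum_rel_def]
proof (elim disjE conjE)
  assume r: "row \<gamma> = int (col \<alpha>)" "row \<delta> = row \<alpha>" "col \<delta> = col \<gamma>"
  then have "row \<alpha> \<noteq> int (col \<gamma>)" "row \<alpha> \<noteq> - row \<gamma>"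
    using pos_root_bounds(1,4)[OF \<alpha>] pos_root_bounds(1,4)[OF \<gamma>] by linarith+
  then show ?thesis
    using r(1) unfolding bracket_root_mat[OF \<alpha> \<gamma>] unfolding root_mat_eq_skew r(2,3) by simp
next
  assume r: "row \<alpha> = int (col \<gamma>)" "row \<delta> = row \<gamma>" "col \<delta> = col \<alpha>"
  then have "row \<gamma> \<noteq> int (col \<alpha>)" "row \<alpha> \<noteq> - row \<gamma>"
    using pos_root_bounds(1,4)[OF \<alpha>] pos_root_bounds(1,4)[OF \<gamma>] by linarith+
  then show ?thesis
    using r(1) unfolding bracket_root_mat[OF \<alpha> \<gamma>] unfolding root_mat_eq_skew r(2,3) by simp
next
  assume r: "row \<alpha> = - row \<gamma>" "col \<delta> = min (col \<alpha>) (col \<gamma>)"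
    "row \<delta> = - int (max (col \<alpha>) (col \<gamma>))"
  have "row \<gamma> \<noteq> int (col \<alpha>)" "row \<alpha> \<noteq> int (col \<gamma>)"
    using r(1) pos_root_bounds(1,4)[OF \<alpha>] pos_root_bounds(1,4)[OF \<gamma>] by linarith+
  then have "bracket \<Phi> n (root_mat \<alpha>) (root_mat \<gamma>) =
      - (skew_mat (- int (col \<alpha>)) (int (col \<gamma>)) :: 'a matrix)"
    using r(1) unfolding bracket_root_mat[OF \<alpha> \<gamma>] by simp
  moreover have "root_mat \<delta> = (skew_mat (- int (col \<alpha>)) (int (col \<gamma>)) :: 'a matrix) \<or>
      root_mat \<delta> = - (skew_mat (- int (col \<alpha>)) (int (col \<gamma>)) :: 'a matrix)"
  proof (cases "col \<alpha> \<le> col \<gamma>")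
    case True
    then have "root_mat \<delta> = (skew_mat (- int (col \<gamma>)) (int (col \<alpha>)) :: 'a matrix)"
      by (simp only: root_mat_eq_skew r(2,3) min_absorb1 max_absorb2)
    then show ?thesis
      using skew_mat_commute[of "int (col \<gamma>)" "int (col \<alpha>)", where 'a = 'a]
      by (intro disjI2) (rule trans)
  next
    case False
    then have "col \<gamma> \<le> col \<alpha>"
      by simp
    then have "root_mat \<delta> = (skew_mat (- int (col \<alpha>)) (int (col \<gamma>)) :: 'a matrix)"
      by (simp only: root_mat_eq_skew r(2,3) min_absorb2 max_absorb1)
    then show ?thesis ..
  qed
  ultimately show ?thesis
    by auto
qed

lemma bracket_root_mat_no_sum:
  assumes \<alpha>: "\<alpha> \<in> pos_roots \<Phi> n" and \<gamma>: "\<gamma> \<in> pos_roots \<Phi> n"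
    and "\<And>\<delta>. \<delta> \<in> pos_roots \<Phi> n \<Longrightarrow> root_vec \<alpha> + root_vec \<gamma> \<noteq> root_vec \<delta>"
  shows "bracket \<Phi> n (root_mat \<alpha>) (root_mat \<gamma>) = 0"
proof -
  have "row \<gamma> \<noteq> int (col \<alpha>)" "row \<alpha> \<noteq> int (col \<gamma>)"
    "row \<alpha> \<noteq> - row \<gamma> \<or> col \<alpha> = col \<gamma>"
    using root_sum_exists[OF \<alpha> \<gamma>] assms(3) by blast+
  \<comment> \<open>In the remaining case of opposite rows and equal columns c, the matrix
    \<open>skew_mat (- int c) (int c)\<close> is a difference of two equal elementary
    matrices.\<close>
  then show ?thesis
    unfolding bracket_root_mat[OF \<alpha> \<gamma>]
    by (cases "row \<alpha> = - row \<gamma>") (simp_all only: if_False if_True, simp_all add: skew_mat_def)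
qed

section \<open>Matrix entries as coordinates in the root basis\<close>

section \<open>Coordinates\<close>

text \<open>Each root owns one matrix position. The second elementary matrix of \<alpha> could meet
  the position of \<beta> only if each of their columns were smaller than the other.\<close>

lemma root_mat_entry:
  assumes \<alpha>: "\<alpha> \<in> pos_roots \<Phi> n" and \<beta>: "\<beta> \<in> pos_roots \<Phi> n"
  shows "root_mat \<alpha> (row \<beta>) (int (col \<beta>)) = (if \<alpha> = \<beta> then 1 else 0)"
proof -
  have "\<not> (row \<beta> = - int (col \<alpha>) \<and> int (col \<beta>) = - row \<alpha>)"
    using pos_root_bounds(1,4)[OF \<alpha>] pos_root_bounds(1,4)[OF \<beta>] by linarith
  then have "elem_mat (- int (col \<alpha>)) (- row \<alpha>) (row \<beta>) (int (col \<beta>)) = (0 :: 'a)"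
    unfolding elem_mat_def by (rule if_not_P)
  moreover have "row \<beta> = row \<alpha> \<and> int (col \<beta>) = int (col \<alpha>) \<longleftrightarrow> \<alpha> = \<beta>"
    using pos_root_eqI[OF \<alpha> \<beta>] by auto
  then have "elem_mat (row \<alpha>) (int (col \<alpha>)) (row \<beta>) (int (col \<beta>)) = (if \<alpha> = \<beta> then 1 else 0 :: 'a)"
    by (simp only: elem_mat_def)
  ultimately show ?thesis
    by (simp only: root_mat_eq_skew skew_mat_def fun_diff_def diff_0_right)
qed

lemma inj_on_root_mat: "inj_on (root_mat :: root \<Rightarrow> 'a::field matrix) (pos_roots \<Phi> n)"
proof (rule inj_onI)
  fix \<alpha> \<beta>
  assume "\<alpha> \<in> pos_roots \<Phi> n" "\<beta> \<in> pos_roots \<Phi> n" "root_mat \<alpha> = (root_mat \<beta> :: 'a matrix)"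
  then have "(if \<alpha> = \<beta> then 1 else 0 :: 'a) = (if \<beta> = \<beta> then 1 else 0)"
    by (simp only: root_mat_entry[symmetric])
  then show "\<alpha> = \<beta>"
    by (simp split: if_splits)
qed

lemma sum_root_mat_entry:
  assumes "\<beta> \<in> pos_roots \<Phi> n"
  shows "(\<Sum>\<alpha>\<in>pos_roots \<Phi> n. mat_scale (c \<alpha>) (root_mat \<alpha>)) (row \<beta>) (int (col \<beta>)) = c \<beta>"
proof -
  have *: "(\<Sum>\<alpha>\<in>A. mat_scale (c \<alpha>) (root_mat \<alpha>)) r s = (\<Sum>\<alpha>\<in>A. c \<alpha> * root_mat \<alpha> r s)" for A r s
    by (induction A rule: infinite_finite_induct) (auto simp: mat_scale_def)
  have "(\<Sum>\<alpha>\<in>pos_roots \<Phi> n. c \<alpha> * root_mat \<alpha> (row \<beta>) (int (col \<beta>))) =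
      (\<Sum>\<alpha>\<in>pos_roots \<Phi> n. if \<alpha> = \<beta> then c \<beta> else 0)"
    using assms by (intro sum.cong) (auto simp: root_mat_entry)
  then show ?thesis
    using assms finite_pos_roots unfolding * by simp
qed

lemma independent_root_mat: "mat.independent (root_mat ` pos_roots \<Phi> n :: 'a::field matrix set)"
proof -
  have "u (root_mat \<beta>) = 0"
    if "(\<Sum>v\<in>root_mat ` pos_roots \<Phi> n. mat_scale (u v) v) = 0" "\<beta> \<in> pos_roots \<Phi> n"
    for u :: "'a matrix \<Rightarrow> 'a" and \<beta>
    using that sum_root_mat_entry[OF that(2), of "\<lambda>\<alpha>. u (root_mat \<alpha> :: 'a matrix)"]
    by (simp add: sum.reindex[OF inj_on_root_mat] zero_fun_def)
  then show ?thesis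
    unfolding mat.dependent_finite[OF finite_imageI[OF finite_pos_roots]] by blast
qed

lemma u_alg_expansion:
  assumes "x \<in> u_alg \<Phi> n"
  shows "x = (\<Sum>\<alpha>\<in>pos_roots \<Phi> n. mat_scale (x (row \<alpha>) (int (col \<alpha>))) (root_mat \<alpha>))"
proof -
  obtain u where "x = (\<Sum>v\<in>root_mat ` pos_roots \<Phi> n. mat_scale (u v) v)"
    using assms unfolding u_alg_def mat.span_finite[OF finite_imageI[OF finite_pos_roots]] by auto
  then have x: "x = (\<Sum>\<alpha>\<in>pos_roots \<Phi> n. mat_scale (u (root_mat \<alpha>)) (root_mat \<alpha>))"
    by (simp add: sum.reindex[OF inj_on_root_mat])
  show ?thesis
    by (subst x, rule sum.cong[OF refl]) (simp add: x sum_root_mat_entry)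
qed

text \<open>Replaces the abstract \<open>representation\<close> by a concrete entry, by comparing
  the basis expansion of x at the position owned by \<beta>.\<close>

lemma dual_root_eq_entry:
  assumes x: "x \<in> u_alg \<Phi> n" and \<beta>: "\<beta> \<in> pos_roots \<Phi> n"
  shows "dual_root \<Phi> n \<beta> x = x (row \<beta>) (int (col \<beta>))"
proof -
  let ?B = "root_mat ` pos_roots \<Phi> n :: 'a matrix set"
  have "(\<Sum>v\<in>?B. mat_scale (mat.representation ?B x v) v) = x"
    using x finite_pos_roots
    by (intro mat.sum_representation_eq independent_root_mat) (auto simp: u_alg_def)
  then have "x = (\<Sum>\<alpha>\<in>pos_roots \<Phi> n. mat_scale (dual_root \<Phi> n \<alpha> x) (root_mat \<alpha>))"
    by (simp add: sum.reindex[OF inj_on_root_mat] dual_root_def)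
  then show ?thesis
    using sum_root_mat_entry[OF \<beta>, of "\<lambda>\<alpha>. dual_root \<Phi> n \<alpha> x"] by simp
qed

section \<open>Closure, isotropy and maximality\<close>

section \<open>The polarization\<close>

text \<open>A linear extension of f from \<open>u_alg\<close> to all matrices, so that linearity
  carries no membership conditions.\<close>

definition entry_form :: "root set \<Rightarrow> (root \<Rightarrow> 'a::field) \<Rightarrow> 'a matrix \<Rightarrow> 'a" where
  "entry_form D \<xi> x = (\<Sum>\<beta>\<in>D. \<xi> \<beta> * x (row \<beta>) (int (col \<beta>)))"

lemma canonical_form_eq_entry_form:
  assumes "D \<subseteq> pos_roots \<Phi> n" "x \<in> u_alg \<Phi> n"
  shows "canonical_form \<Phi> n D \<xi> x = entry_form D \<xi> x"
  unfolding canonical_form_def entry_form_def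
  using assms by (intro sum.cong refl) (metis dual_root_eq_entry subsetD)

lemma entry_form_zero: "entry_form D \<xi> 0 = 0"
  by (simp add: entry_form_def)

lemma entry_form_add: "entry_form D \<xi> (x + y) = entry_form D \<xi> x + entry_form D \<xi> y"
  by (simp add: entry_form_def distrib_left sum.distrib)

lemma entry_form_scale: "entry_form D \<xi> (mat_scale c x) = c * entry_form D \<xi> x"
  by (simp add: entry_form_def mat_scale_def sum_distrib_left mult.left_commute)

lemma entry_form_minus: "entry_form D \<xi> (- x) = - entry_form D \<xi> x"
  by (simp add: entry_form_def sum_negf)

lemma entry_form_sum: "entry_form D \<xi> (\<Sum>i\<in>I. x i) = (\<Sum>i\<in>I. entry_form D \<xi> (x i))"
  by (induction I rule: infinite_finite_induct) (simp_all only: sum.infinite sum.empty sum.insert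
      entry_form_zero entry_form_add not_False_eq_True)

lemma entry_form_root_mat:
  assumes "D \<subseteq> pos_roots \<Phi> n" "\<delta> \<in> pos_roots \<Phi> n"
  shows "entry_form D \<xi> (root_mat \<delta>) = (if \<delta> \<in> D then \<xi> \<delta> else 0)"
proof -
  have "finite D"
    using assms(1) finite_pos_roots finite_subset by blast
  have "entry_form D \<xi> (root_mat \<delta>) = (\<Sum>\<beta>\<in>D. if \<delta> = \<beta> then \<xi> \<beta> else 0)"
    unfolding entry_form_def
  proof (rule sum.cong[OF refl])
    fix \<beta>
    assume "\<beta> \<in> D"
    then have "root_mat \<delta> (row \<beta>) (int (col \<beta>)) = (if \<delta> = \<beta> then 1 else 0 :: 'a)"
      using assms by (intro root_mat_entry) auto
    then show "\<xi> \<beta> * root_mat \<delta> (row \<beta>) (int (col \<beta>)) = (if \<delta> = \<beta> then \<xi> \<beta> else 0)"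
      by simp
  qed
  also have "\<dots> = (if \<delta> \<in> D then \<xi> \<delta> else 0)"
    using \<open>finite D\<close> by (rule sum.delta')
  finally show ?thesis .
qed

lemma subspace_entry_form_zero: "mat.subspace {x. entry_form D \<xi> x = 0}"
  by (rule mat.subspaceI) (simp_all add: entry_form_zero entry_form_add entry_form_scale)

text \<open>The bracket is a root vector up to sign, or zero. Read contrapositively, a bracket
  outside S exhibits a root that is the sum.\<close>

lemma bracket_root_mat_mem_subspace:
  assumes S: "mat.subspace S" and "\<alpha> \<in> pos_roots \<Phi> n" "\<gamma> \<in> pos_roots \<Phi> n"
    and "\<And>\<delta>. \<delta> \<in> pos_roots \<Phi> n \<Longrightarrow> root_vec \<alpha> + root_vec \<gamma> = root_vec \<delta> \<Longrightarrow> root_mat \<delta> \<in> S"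
  shows "bracket \<Phi> n (root_mat \<alpha>) (root_mat \<gamma>) \<in> S"
proof (cases "\<exists>\<delta> \<in> pos_roots \<Phi> n. root_vec \<alpha> + root_vec \<gamma> = root_vec \<delta>")
  case True
  then obtain \<delta> where \<delta>: "\<delta> \<in> pos_roots \<Phi> n" "root_vec \<alpha> + root_vec \<gamma> = root_vec \<delta>"
    by blast
  then show ?thesis
    using bracket_root_mat_sum[OF assms(2,3) \<delta>, where 'a = 'a] assms(4)[OF \<delta>] mat.subspace_neg[OF S]
    by (elim insertE) (simp_all only: empty_iff)
next
  case False
  then have "bracket \<Phi> n (root_mat \<alpha>) (root_mat \<gamma>) = (0 :: 'a matrix)"
    using assms(2,3) by (intro bracket_root_mat_no_sum) blast+
  then show ?thesis
    using mat.subspace_0[OF S] by (simp only:)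
qed

lemma bracket_u_alg:
  assumes "x \<in> u_alg \<Phi> n" "y \<in> u_alg \<Phi> n"
  shows "bracket \<Phi> n x y \<in> u_alg \<Phi> n"
proof (rule bracket_span_in_subspace)
  show "x \<in> mat.span (root_mat ` pos_roots \<Phi> n)" "y \<in> mat.span (root_mat ` pos_roots \<Phi> n)"
    using assms by (simp_all only: u_alg_def)
  show "mat.subspace (u_alg \<Phi> n)"
    unfolding u_alg_def by (rule mat.subspace_span)
  fix a b :: "'a matrix"
  assume "a \<in> root_mat ` pos_roots \<Phi> n" "b \<in> root_mat ` pos_roots \<Phi> n"
  then obtain \<alpha> \<gamma> where *: "\<alpha> \<in> pos_roots \<Phi> n" "a = root_mat \<alpha>" "\<gamma> \<in> pos_roots \<Phi> n" "b = root_mat \<gamma>"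
    by blast
  show "bracket \<Phi> n a b \<in> u_alg \<Phi> n"
    unfolding *(2,4) u_alg_def
    by (rule bracket_root_mat_mem_subspace[OF mat.subspace_span *(1,3)]) (intro mat.span_base imageI)
qed

lemma P_set_subset: "P_set \<Phi> n D \<subseteq> pos_roots \<Phi> n"
  by (auto simp: P_set_def)

lemma p_alg_subset: "p_alg \<Phi> n D \<subseteq> u_alg \<Phi> n"
  unfolding p_alg_def u_alg_def by (intro mat.span_mono image_mono P_set_subset)

text \<open>Serves twice: with S the space p itself for closure, and with S the kernel of
  \<open>entry_form\<close> for isotropy.\<close>

lemma bracket_p_alg:
  assumes S: "mat.subspace S" and x: "x \<in> p_alg \<Phi> n D" and y: "y \<in> p_alg \<Phi> n D"
    and *: "\<And>\<alpha> \<gamma> \<delta>. \<alpha> \<in> P_set \<Phi> n D \<Longrightarrow> \<gamma> \<in> P_set \<Phi> n D \<Longrightarrow> \<delta> \<in> pos_roots \<Phi> n \<Longrightarrow>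
      root_vec \<alpha> + root_vec \<gamma> = root_vec \<delta> \<Longrightarrow> root_mat \<delta> \<in> S"
  shows "bracket \<Phi> n x y \<in> S"
proof (rule bracket_span_in_subspace[OF S _ x[unfolded p_alg_def] y[unfolded p_alg_def]])
  fix a b :: "'a matrix"
  assume "a \<in> root_mat ` P_set \<Phi> n D" "b \<in> root_mat ` P_set \<Phi> n D"
  then obtain \<alpha> \<gamma> where **: "\<alpha> \<in> P_set \<Phi> n D" "a = root_mat \<alpha>" "\<gamma> \<in> P_set \<Phi> n D" "b = root_mat \<gamma>"
    by blast
  then have "\<alpha> \<in> pos_roots \<Phi> n" "\<gamma> \<in> pos_roots \<Phi> n"
    using P_set_subset by blast+
  then show "bracket \<Phi> n a b \<in> S"
    unfolding **(2,4) using *[OF **(1,3)] by (intro bracket_root_mat_mem_subspace[OF S])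
qed

text \<open>The conditions on x form a triangular system with respect to \<open>col \<beta>\<close>.
  The hypotheses on \<beta>, \<gamma>, \<delta> are those delivered by \<open>P_set_partner\<close>,
  so the induction may pass to another triple.\<close>

lemma isotropic_entry_zero:
  fixes x :: "'a::field matrix"
  assumes D: "orthogonal_rook_placement \<Phi> n D" and nz: "\<And>\<beta>. \<beta> \<in> D \<Longrightarrow> \<xi> \<beta> \<noteq> 0"
    and x: "x \<in> u_alg \<Phi> n"
    and iso: "\<And>\<gamma>. \<gamma> \<in> P_set \<Phi> n D \<Longrightarrow> entry_form D \<xi> (bracket \<Phi> n (root_mat \<gamma>) x) = 0"
    and "\<beta> \<in> D" "\<gamma> \<in> P_set \<Phi> n D" "\<delta> \<in> pos_roots \<Phi> n" "\<delta> \<notin> P_set \<Phi> n D"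
    and "root_vec \<gamma> + root_vec \<delta> = root_vec \<beta>" "col \<gamma> = col \<beta>" "col \<beta> < col \<delta>"
  shows "x (row \<delta>) (int (col \<delta>)) = 0"
  using assms(5-)
proof (induction "col \<beta>" arbitrary: \<beta> \<gamma> \<delta> rule: less_induct)
  case less
  let ?c = "\<lambda>\<alpha>. x (row \<alpha>) (int (col \<alpha>))"
  let ?f = "\<lambda>\<alpha>. entry_form D \<xi> (bracket \<Phi> n (root_mat \<gamma>) (root_mat \<alpha>))"
  have Dpos: "D \<subseteq> pos_roots \<Phi> n"
    using D by (simp add: orthogonal_rook_placement_def)
  have \<beta>: "\<beta> \<in> pos_roots \<Phi> n" and \<gamma>: "\<gamma> \<in> pos_roots \<Phi> n"
    using Dpos less.prems(1,2) P_set_subset by blast+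
  have other: "?c \<alpha> * ?f \<alpha> = 0" if \<alpha>: "\<alpha> \<in> pos_roots \<Phi> n" "\<alpha> \<noteq> \<delta>" for \<alpha>
  proof (rule ccontr)
    assume *: "?c \<alpha> * ?f \<alpha> \<noteq> 0"
    then have "bracket \<Phi> n (root_mat \<gamma>) (root_mat \<alpha>) \<notin> {y. entry_form D \<xi> y = 0}"
      by auto
    then obtain \<beta>' where \<beta>': "\<beta>' \<in> pos_roots \<Phi> n" "root_vec \<gamma> + root_vec \<alpha> = root_vec \<beta>'"
      "root_mat \<beta>' \<notin> {y. entry_form D \<xi> y = 0}"
      using bracket_root_mat_mem_subspace[OF subspace_entry_form_zero \<gamma> \<alpha>(1)] by blast
    then have "\<beta>' \<in> D"
      using entry_form_root_mat[OF Dpos \<beta>'(1), of \<xi>] by (auto split: if_splits)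
    then have "\<alpha> \<notin> P_set \<Phi> n D"
      using P_set_closed(2)[OF D less.prems(2) _ \<beta>'(1,2)] by blast
    then obtain \<beta>'' \<gamma>'' where **: "\<beta>'' \<in> D" "\<gamma>'' \<in> P_set \<Phi> n D"
      "root_vec \<gamma>'' + root_vec \<alpha> = root_vec \<beta>''" "col \<gamma>'' = col \<beta>''" "col \<beta>'' < col \<alpha>"
      by (rule P_set_partner[OF D \<alpha>(1)])
    \<comment> \<open>Otherwise \<alpha> and \<delta> would both be the difference of \<beta> and
      \<gamma>.\<close>
    have "\<beta>' \<noteq> \<beta>"
    proof
      assume "\<beta>' = \<beta>"
      then have "root_vec \<alpha> = root_vec \<delta>"
        using \<beta>'(2) less.prems(5) by (metis add_left_cancel)
      then show False
        using root_vec_inj[OF \<alpha>(1) less.prems(3)] \<alpha>(2) by blast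
    qed
    then have "col \<beta>' \<noteq> col \<beta>"
      using orthogonal_rook_placement_inj_on_col[OF D] \<open>\<beta>' \<in> D\<close> less.prems(1)
      by (auto dest: inj_onD)
    \<comment> \<open>The column of \<beta>' is the smaller of
      \<open>col \<gamma> = col \<beta>\<close> and \<open>col \<alpha>\<close>; as it is not
      \<open>col \<beta>\<close>, it must be \<open>col \<alpha>\<close>.\<close>
    then have "col \<alpha> < col \<beta>"
      using col_root_sum(1)[OF \<gamma> \<alpha>(1) \<beta>'(1,2)] less.prems(6) by linarith
    \<comment> \<open>The induction hypothesis is used for \<beta>'', whose pair accounts for
      \<alpha> being outside \<open>P_set\<close>; its column is smaller than
      \<open>col \<alpha>\<close>.\<close>
    then have "?c \<alpha> = 0"
      using less.hyps[OF _ **(1,2) \<alpha>(1) \<open>\<alpha> \<notin> P_set \<Phi> n D\<close> **(3-5)] **(5) by linarith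
    then show False
      using * by simp
  qed
  interpret b: Vector_Spaces.linear mat_scale mat_scale "bracket \<Phi> n (root_mat \<gamma> :: 'a matrix)"
    by (rule linear_bracket_right)
  have "0 = entry_form D \<xi> (bracket \<Phi> n (root_mat \<gamma>) x)"
    using iso[OF less.prems(2)] by simp
  also have "\<dots> = entry_form D \<xi> (bracket \<Phi> n (root_mat \<gamma>)
      (\<Sum>\<alpha>\<in>pos_roots \<Phi> n. mat_scale (?c \<alpha>) (root_mat \<alpha>)))"
    by (simp only: u_alg_expansion[OF x, symmetric])
  also have "\<dots> = (\<Sum>\<alpha>\<in>pos_roots \<Phi> n. ?c \<alpha> * ?f \<alpha>)"
    by (simp only: b.sum b.scale entry_form_sum entry_form_scale)
  also have "\<dots> = (\<Sum>\<alpha>\<in>{\<delta>}. ?c \<alpha> * ?f \<alpha>)"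
    using other less.prems(3) finite_pos_roots by (intro sum.mono_neutral_right) auto
  finally have "?c \<delta> * ?f \<delta> = 0"
    by simp
  moreover have "?f \<delta> \<in> {\<xi> \<beta>, - \<xi> \<beta>}"
    using bracket_root_mat_sum[OF \<gamma> less.prems(3) \<beta> less.prems(5), where 'a = 'a]
      entry_form_root_mat[OF Dpos \<beta>, of \<xi>] less.prems(1)
    by (elim insertE) (simp_all only: entry_form_minus if_True insert_iff simp_thms empty_iff)
  ultimately show ?case
    using nz[OF less.prems(1)] by auto
qed

theorem theorem3p7:
  fixes \<Phi> :: root_type and n :: nat and D :: "root set"
    and \<xi> :: "root \<Rightarrow> 'a::finite_field"
  assumes "CHAR('a) \<ge> n"
    and "orthogonal_rook_placement \<Phi> n D"
    and "\<And>\<beta>. \<beta> \<in> D \<Longrightarrow> \<xi> \<beta> \<noteq> 0"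
  shows "polarization (bracket \<Phi> n) (u_alg \<Phi> n :: 'a matrix set)
           (canonical_form \<Phi> n D \<xi>) (p_alg \<Phi> n D)"
proof -
  note D = assms(2)
  have Dpos: "D \<subseteq> pos_roots \<Phi> n"
    using D by (simp add: orthogonal_rook_placement_def)
  have sub: "mat.subspace (p_alg \<Phi> n D :: 'a matrix set)"
    unfolding p_alg_def by (rule mat.subspace_span)
  have base: "root_mat \<alpha> \<in> (p_alg \<Phi> n D :: 'a matrix set)" if "\<alpha> \<in> P_set \<Phi> n D" for \<alpha>
    unfolding p_alg_def using that by (intro mat.span_base imageI)
  have lie: "bracket \<Phi> n x y \<in> p_alg \<Phi> n D" if "x \<in> p_alg \<Phi> n D" "y \<in> p_alg \<Phi> n D" for x y :: "'a matrix"
    using bracket_p_alg[OF sub that] P_set_closed(1)[OF D] base by blast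
  have iso: "canonical_form \<Phi> n D \<xi> (bracket \<Phi> n x y) = 0"
    if "x \<in> p_alg \<Phi> n D" "y \<in> p_alg \<Phi> n D" for x y
  proof -
    have "bracket \<Phi> n x y \<in> {z. entry_form D \<xi> z = 0}"
      by (rule bracket_p_alg[OF subspace_entry_form_zero that])
        (simp add: entry_form_root_mat[OF Dpos] P_set_closed(2)[OF D])
    \<comment> \<open>Membership in u is what allows the passage between
      \<open>canonical_form\<close> and \<open>entry_form\<close>.\<close>
    moreover have "bracket \<Phi> n x y \<in> u_alg \<Phi> n"
      using lie[OF that] p_alg_subset by blast
    ultimately show ?thesis
      by (simp add: canonical_form_eq_entry_form[OF Dpos])
  qed
  have max: "p' = p_alg \<Phi> n D"
    if p': "isotropic_subspace (bracket \<Phi> n) (u_alg \<Phi> n) (canonical_form \<Phi> n D \<xi>) p'"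
      "p_alg \<Phi> n D \<subseteq> p'" for p'
  proof
    show "p' \<subseteq> p_alg \<Phi> n D"
    proof
      fix x
      assume x: "x \<in> p'"
      have u: "p' \<subseteq> u_alg \<Phi> n"
        using p'(1) by (simp add: isotropic_subspace_def)
      then have xu: "x \<in> u_alg \<Phi> n"
        using x by blast
      have orth: "entry_form D \<xi> (bracket \<Phi> n (root_mat \<gamma>) x) = 0" if "\<gamma> \<in> P_set \<Phi> n D" for \<gamma>
      proof -
        have \<gamma>: "root_mat \<gamma> \<in> p'"
          using base[OF that] p'(2) by blast
        then have "bracket \<Phi> n (root_mat \<gamma>) x \<in> u_alg \<Phi> n"
          using u xu by (intro bracket_u_alg) auto
        then show ?thesis
          using canonical_form_eq_entry_form[OF Dpos, of "bracket \<Phi> n (root_mat \<gamma>) x" \<xi>] p'(1) x \<gamma>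
          by (simp add: isotropic_subspace_def)
      qed
      have zero: "x (row \<delta>) (int (col \<delta>)) = 0"
        if \<delta>: "\<delta> \<in> pos_roots \<Phi> n" "\<delta> \<notin> P_set \<Phi> n D" for \<delta>
      proof -
        obtain \<beta> \<gamma> where *: "\<beta> \<in> D" "\<gamma> \<in> P_set \<Phi> n D" "root_vec \<gamma> + root_vec \<delta> = root_vec \<beta>"
          "col \<gamma> = col \<beta>" "col \<beta> < col \<delta>"
          by (rule P_set_partner[OF D \<delta>])
        show ?thesis
          by (rule isotropic_entry_zero[OF D assms(3) xu orth *(1,2) \<delta> *(3-5)])
      qed
      \<comment> \<open>Each term of the expansion of x lies in p: either its root is in
        \<open>P_set\<close>, or its coefficient vanishes.\<close>
      have "mat_scale (x (row \<alpha>) (int (col \<alpha>))) (root_mat \<alpha>) \<in> p_alg \<Phi> n D"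
        if "\<alpha> \<in> pos_roots \<Phi> n" for \<alpha>
        using base[of \<alpha>] zero[OF that] mat.subspace_0[OF sub] mat.subspace_scale[OF sub]
        by (cases "\<alpha> \<in> P_set \<Phi> n D") (simp_all only: mat.scale_zero_left not_False_eq_True)
      then show "x \<in> p_alg \<Phi> n D"
        by (subst u_alg_expansion[OF xu]) (intro mat.subspace_sum[OF sub])
    qed
  qed (rule p'(2))
  show ?thesis
    unfolding polarization_def lie_subalgebra_def isotropic_subspace_def
    using sub p_alg_subset lie iso max[unfolded isotropic_subspace_def] by blast
qed

end
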